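(* Let $M$ be a compact 3-manifold with a triangulation $\tau$ (possibly a pseudo-triangulation), and let $F$ be a normal surface in $M$, no component of which is a vertex-linking sphere. Let $T$ and $Q$ be the number of normal triangles and normal quadrilaterals of $F$, respectively. Let $N$ be the maximum number of tetrahedra linking a vertex of $\tau$, that is, the maximum over all vertices $v$ of $\tau$ of the number $N_v$ of tetrahedra containing $v$. Then $$T \leq 4 N Q.$$
   Context: A pseudo-triangulation is a complex in which each 3-cell is a tetrahedron whose interior is embedded, but whose boundary need not be mapped injectively (faces, edges or vertices of the same tetrahedron may be identified). Ordinary triangulations are included. A normal disk in a tetrahedron $\Delta$ is a disk that can be isotoped, by an isotopy that is invariant on each simplex (a normal isotopy), to one of 7 types: 4 normal triangles (one for each vertex $v$ of $\Delta$, separating $v$ from the other three vertices; such a triangle is said to link $v$) and 3 normal quadrilaterals (one for each pair of opposite edges of $\Delta$, separating these two edges and meeting each of the other four edges once). A surface $F$ in $M$ is normal if it is properly embedded in $M$, intersects each simplex of $\tau$ transversally, and intersects each tetrahedron in a disjoint union of normal disks. $T$ and $Q$ are the total numbers of normal triangles and normal quadrilaterals among these disks. For a vertex $v$ of $\tau$, the vertex-linking sphere $S(v)$ linking $v$ is the boundary of a small ball neighbourhood of $v$; it is a normal surface composed of normal triangles linking $v$, one from each normal isotopy class.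
   Formalization: N_v counts a tetrahedron once for each of its corners at v (the same as the number of tetrahedra for ordinary triangulations), and components that are vertex-linking disks at boundary vertices are excluded along with vertex-linking spheres; the bound fails otherwise. *)

theory Defs
  imports "HOL-Analysis.Analysis"
begin

section \<open>Manifolds with boundary\<close>

text \<open>The dimension is that of the Euclidean type \<open>'e\<close>. Spaces are subsets of a Hausdorff
  type with the subspace topology. Second countability is not listed: the definition is used
  for compact sets only, where it is automatic.\<close>

definition manifold_with_boundary :: "'e::euclidean_space itself \<Rightarrow> 'a::t2_space set \<Rightarrow> bool" where
  "manifold_with_boundary _ M \<longleftrightarrow>
     (\<forall>x\<in>M. \<exists>U b (V :: 'e set). openin (top_of_set M) U \<and> x \<in> U \<and> b \<noteq> 0 \<and>
        openin (top_of_set {y. 0 \<le> b \<bullet> y}) V \<and> U homeomorphic V)"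

definition manifold_interior :: "'e::euclidean_space itself \<Rightarrow> 'a::t2_space set \<Rightarrow> 'a set" where
  "manifold_interior _ M =
     {x \<in> M. \<exists>U (V :: 'e set). openin (top_of_set M) U \<and> x \<in> U \<and> open V \<and> U homeomorphic V}"

definition manifold_boundary :: "'e::euclidean_space itself \<Rightarrow> 'a::t2_space set \<Rightarrow> 'a set" where
  "manifold_boundary d M = M - manifold_interior d M"

definition compact_3_manifold :: "'a::t2_space set \<Rightarrow> bool" where
  "compact_3_manifold M \<longleftrightarrow> compact M \<and> manifold_with_boundary TYPE(real^3) M"

definition properly_embedded_surface :: "'a::t2_space set \<Rightarrow> 'a set \<Rightarrow> bool" where
  "properly_embedded_surface M F \<longleftrightarrow>
     closedin (top_of_set M) F \<and> manifold_with_boundary TYPE(real^2) F \<and>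
     manifold_boundary TYPE(real^2) F = F \<inter> manifold_boundary TYPE(real^3) M"


section \<open>The tetrahedron\<close>

text \<open>Barycentric coordinates: the vertices of the model tetrahedron are the four unit vectors
  \<open>axis i 1\<close>, and a point lies in the relatively open face spanned by its support.\<close>

definition tetra :: "(real^4) set" where
  "tetra = {x. (\<forall>i. 0 \<le> x $ i) \<and> (\<Sum>i\<in>UNIV. x $ i) = 1}"

definition support :: "real^4 \<Rightarrow> 4 set" where
  "support x = {i. x $ i \<noteq> 0}"

definition face :: "4 set \<Rightarrow> (real^4) set" where
  "face S = {x \<in> tetra. support x \<subseteq> S}"

definition open_face :: "4 set \<Rightarrow> (real^4) set" where
  "open_face S = {x \<in> tetra. support x = S}"

abbreviation corner :: "4 \<Rightarrow> real^4" where
  "corner i \<equiv> axis i 1"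

definition permute_coords :: "(4 \<Rightarrow> 4) \<Rightarrow> real^4 \<Rightarrow> real^4" where
  "permute_coords \<pi> x = (\<chi> i. x $ \<pi> i)"


section \<open>Pseudo-triangulations\<close>

text \<open>The complex is given by characteristic maps \<open>\<phi> s\<close>, one for each tetrahedron \<open>s \<in> I\<close>. Open
  faces of every dimension are embedded, open tetrahedra are disjoint from all other cells, and
  whenever two open faces (of one or of two tetrahedra) meet in \<open>M\<close>, the closed faces are
  identified by a simplicial isomorphism. The latter extends to a permutation of the four
  vertices, which is why all identifications are written with \<open>permute_coords\<close>. As \<open>M\<close> is
  Hausdorff and \<open>I\<close> is finite, \<open>M\<close> carries the quotient topology.\<close>

definition pseudo_triangulation ::
    "'a::t2_space set \<Rightarrow> 'i set \<Rightarrow> ('i \<Rightarrow> real^4 \<Rightarrow> 'a) \<Rightarrow> bool" where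
  "pseudo_triangulation M I \<phi> \<longleftrightarrow>
     finite I \<and>
     (\<forall>s\<in>I. continuous_on tetra (\<phi> s)) \<and>
     M = (\<Union>s\<in>I. \<phi> s ` tetra) \<and>
     (\<forall>s\<in>I. \<forall>S. inj_on (\<phi> s) (open_face S)) \<and>
     (\<forall>s\<in>I. \<forall>t\<in>I. \<forall>x\<in>open_face UNIV. \<forall>y\<in>tetra. \<phi> s x = \<phi> t y \<longrightarrow> s = t \<and> x = y) \<and>
     (\<forall>s\<in>I. \<forall>t\<in>I. \<forall>x\<in>tetra. \<forall>y\<in>tetra. \<phi> s x = \<phi> t y \<longrightarrow>
        (\<exists>\<pi>. bij \<pi> \<and> y = permute_coords \<pi> x \<and>
             (\<forall>z\<in>face (support x). \<phi> t (permute_coords \<pi> z) = \<phi> s z)))"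

definition vertices :: "'i set \<Rightarrow> ('i \<Rightarrow> real^4 \<Rightarrow> 'a) \<Rightarrow> 'a set" where
  "vertices I \<phi> = {\<phi> s (corner i) | s i. s \<in> I}"

text \<open>The number of tetrahedra linking \<open>v\<close>: a tetrahedron with several corners at \<open>v\<close> is counted
  once for each of them, so that this is the number of normal triangles composing the vertex link
  of \<open>v\<close>. In an ordinary triangulation it is the number of tetrahedra containing \<open>v\<close>.\<close>

definition linking_number :: "'i set \<Rightarrow> ('i \<Rightarrow> real^4 \<Rightarrow> 'a) \<Rightarrow> 'a \<Rightarrow> nat" where
  "linking_number I \<phi> v = card {(s, i). s \<in> I \<and> \<phi> s (corner i) = v}"

definition max_linking_number :: "'i set \<Rightarrow> ('i \<Rightarrow> real^4 \<Rightarrow> 'a) \<Rightarrow> nat" where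
  "max_linking_number I \<phi> = Max (linking_number I \<phi> ` vertices I \<phi>)"


section \<open>Normal disks\<close>

definition normal_isotopy :: "(real \<Rightarrow> real^4 \<Rightarrow> real^4) \<Rightarrow> bool" where
  "normal_isotopy H \<longleftrightarrow>
     continuous_on ({0..1} \<times> tetra) (\<lambda>(t, x). H t x) \<and>
     (\<forall>x\<in>tetra. H 0 x = x) \<and>
     (\<forall>t\<in>{0..1}. (\<exists>g. homeomorphism tetra tetra (H t) g) \<and> (\<forall>S. H t ` face S = face S))"

definition normally_isotopic :: "(real^4) set \<Rightarrow> (real^4) set \<Rightarrow> bool" where
  "normally_isotopic D E \<longleftrightarrow> D \<subseteq> tetra \<and> (\<exists>H. normal_isotopy H \<and> H 1 ` D = E)"

definition normal_triangle :: "4 \<Rightarrow> (real^4) set \<Rightarrow> bool" where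
  "normal_triangle i D \<longleftrightarrow> normally_isotopic D {x \<in> tetra. x $ i = 1/2}"

text \<open>The model quadrilateral for \<open>i \<noteq> j\<close> separates the edge \<open>ij\<close> from the opposite edge; the
  opposite edge gives the same quadrilateral.\<close>

definition normal_quad :: "(real^4) set \<Rightarrow> bool" where
  "normal_quad D \<longleftrightarrow> (\<exists>i j. i \<noteq> j \<and> normally_isotopic D {x \<in> tetra. x $ i + x $ j = 1/2})"

definition normal_disk :: "(real^4) set \<Rightarrow> bool" where
  "normal_disk D \<longleftrightarrow> (\<exists>i. normal_triangle i D) \<or> normal_quad D"


section \<open>Normal surfaces\<close>

text \<open>Since tetrahedra are not embedded, the intersection of a set with the tetrahedron \<open>s\<close> is taken
  in the model tetrahedron.\<close>

definition trace :: "('i \<Rightarrow> real^4 \<Rightarrow> 'a) \<Rightarrow> 'a set \<Rightarrow> 'i \<Rightarrow> (real^4) set" where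
  "trace \<phi> F s = {x \<in> tetra. \<phi> s x \<in> F}"

text \<open>Topological transversality of a properly embedded surface \<open>F\<close> and an open simplex \<open>\<sigma>\<close>: near each
  common point, some chart of \<open>M\<close> turns them into a plane and an affine subspace that together
  span. (A vertex would be a point in a plane, so \<open>F\<close> avoids the vertices.)\<close>

definition transverse :: "'a::t2_space set \<Rightarrow> 'a set \<Rightarrow> 'a set \<Rightarrow> bool" where
  "transverse M F \<sigma> \<longleftrightarrow>
     (\<forall>x \<in> F \<inter> \<sigma>. \<exists>U b (V :: (real^3) set) h g P L.
        openin (top_of_set M) U \<and> x \<in> U \<and> b \<noteq> 0 \<and>
        openin (top_of_set {y. 0 \<le> b \<bullet> y}) V \<and> homeomorphism U V h g \<and>
        affine P \<and> aff_dim P = 2 \<and> affine L \<and>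
        h ` (F \<inter> U) = P \<inter> V \<and> h ` (\<sigma> \<inter> U) = L \<inter> V \<and>
        {p + l | p l. p \<in> P \<and> l \<in> L} = UNIV)"

text \<open>A finite disjoint union of (compact, connected) disks is the union of its connected components,
  so the disks of \<open>F\<close> in the tetrahedron \<open>s\<close> are the components of the trace.\<close>

definition pieces :: "('i \<Rightarrow> real^4 \<Rightarrow> 'a) \<Rightarrow> 'a set \<Rightarrow> 'i \<Rightarrow> (real^4) set set" where
  "pieces \<phi> F s = components (trace \<phi> F s)"

definition normal_surface ::
    "'a::t2_space set \<Rightarrow> 'i set \<Rightarrow> ('i \<Rightarrow> real^4 \<Rightarrow> 'a) \<Rightarrow> 'a set \<Rightarrow> bool" where
  "normal_surface M I \<phi> F \<longleftrightarrow>
     properly_embedded_surface M F \<and>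
     (\<forall>s\<in>I. \<forall>S. transverse M F (\<phi> s ` open_face S)) \<and>
     (\<forall>s\<in>I. finite (pieces \<phi> F s) \<and> (\<forall>D\<in>pieces \<phi> F s. normal_disk D))"

definition num_triangles :: "'i set \<Rightarrow> ('i \<Rightarrow> real^4 \<Rightarrow> 'a) \<Rightarrow> 'a set \<Rightarrow> nat" where
  "num_triangles I \<phi> F = card {(s, D). s \<in> I \<and> D \<in> pieces \<phi> F s \<and> (\<exists>i. normal_triangle i D)}"

definition num_quads :: "'i set \<Rightarrow> ('i \<Rightarrow> real^4 \<Rightarrow> 'a) \<Rightarrow> 'a set \<Rightarrow> nat" where
  "num_quads I \<phi> F = card {(s, D). s \<in> I \<and> D \<in> pieces \<phi> F s \<and> normal_quad D}"

text \<open>\<open>C\<close> is a copy of \<open>S(v)\<close>: it is composed of one normal triangle \<open>D s i\<close> for each corner \<open>i\<close> of a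
  tetrahedron \<open>s\<close> lying at \<open>v\<close>. If \<open>v\<close> lies on the boundary of \<open>M\<close>, then \<open>S(v)\<close>, the frontier of a small
  ball neighbourhood of \<open>v\<close>, is a properly embedded disk rather than a sphere.\<close>

definition vertex_linking ::
    "'i set \<Rightarrow> ('i \<Rightarrow> real^4 \<Rightarrow> 'a) \<Rightarrow> 'a \<Rightarrow> 'a set \<Rightarrow> bool" where
  "vertex_linking I \<phi> v C \<longleftrightarrow>
     (\<exists>D. \<forall>s\<in>I. let K = {i. \<phi> s (corner i) = v} in
        (\<forall>i\<in>K. normal_triangle i (D s i)) \<and> disjoint_family_on (D s) K \<and>
        trace \<phi> C s = (\<Union>i\<in>K. D s i))"

end

theory Submission
  imports Defs
begin

text \<open>Give each normal triangle linking a corner the level \<open>k\<close>, the number of points of the surface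
  between it and the corner on an edge; disjointness of the disks makes \<open>k\<close> independent of the edge.
  A vertex \<open>v\<close> and a level \<open>k\<close> determine at most one triangle per corner at \<open>v\<close>, hence at most \<open>N\<close>
  triangles. If such a class is nonempty, some quadrilateral meets a face in an arc that cuts off a
  corner at \<open>v\<close> at level \<open>k\<close>: otherwise every disk adjacent to a triangle of the class belongs to the
  class, and as neither the surface nor \<open>M\<close> has local cut points, the class is a component of the
  surface and contains one triangle for every corner at \<open>v\<close>, that is, it is a vertex link. As each
  quadrilateral has four such arcs, there are at most \<open>4 Q\<close> nonempty classes.\<close>

text \<open>The gluing data are pointwise: they do not tell how the tetrahedra are arranged around
  an edge or a vertex, and one tetrahedron may occur there several times. The proof does not
  reconstruct this arrangement. It splits what lies around a point into two closed parts, the class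
  under study and the rest, and shows that near the point gluings never join the two except at the
  point itself. If both parts occurred, the point would be a local cut point, which a manifold of
  dimension at least 2 does not have. This is applied to \<open>F\<close> at its points on edges and
  to \<open>M\<close> at vertices. Levels can be compared between tetrahedra because they count
  points of \<open>F\<close> on an edge, and gluings identify edges together with their barycentric
  parameter.\<close>

section \<open>Local cut points\<close>

text \<open>A chart carries a small neighbourhood of \<open>p\<close> that avoids \<open>Z\<close>
  onto a convex piece of a half-space. Removing one point from a convex set of dimension at least 2
  leaves it connected, whereas \<open>X\<close> and \<open>Y\<close> would split it into two
  nonempty relatively closed parts. \<open>Z\<close> absorbs everything away from \<open>p\<close>,
  so that covering and disjointness matter only near \<open>p\<close>.\<close>

lemma no_local_cut_point:
  fixes p :: "'a::t2_space"
  assumes mf: "manifold_with_boundary TYPE('e::euclidean_space) A" and dim: "2 \<le> DIM('e)"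
    and cl: "closed X" "closed Y" "closed Z"
    and cov: "A \<subseteq> X \<union> Y \<union> Z" and p: "p \<in> A" "p \<notin> Z"
    and int: "X \<inter> Y \<subseteq> insert p Z"
    and X: "\<And>W. openin (top_of_set A) W \<Longrightarrow> p \<in> W \<Longrightarrow> \<exists>x\<in>X \<inter> W. x \<noteq> p"
    and Y: "\<And>W. openin (top_of_set A) W \<Longrightarrow> p \<in> W \<Longrightarrow> \<exists>x\<in>Y \<inter> W. x \<noteq> p"
  shows False
proof -
  obtain U b and V :: "'e set" where U: "openin (top_of_set A) U" "p \<in> U" and b: "b \<noteq> 0"
    and V: "openin (top_of_set {y. 0 \<le> b \<bullet> y}) V" and "U homeomorphic V"
    using mf p(1) unfolding manifold_with_boundary_def by blast
  then obtain h g where hg: "homeomorphism U V h g"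
    unfolding homeomorphic_def by blast
  have hU: "h ` U = V" and cg: "continuous_on V g"
    and gh: "\<And>x. x \<in> U \<Longrightarrow> g (h x) = x" and hgy: "\<And>y. y \<in> V \<Longrightarrow> h (g y) = y"
    using hg by (auto simp: homeomorphism_def)
  have "openin (top_of_set U) (U - Z)"
    using cl(3) by (metis Diff_eq open_Compl openin_open_Int)
  then have "openin (top_of_set V) (h ` (U - Z))"
    using hg homeomorphism_imp_open_map by blast
  then have "openin (top_of_set {y. 0 \<le> b \<bullet> y}) (h ` (U - Z))"
    using V openin_trans by blast
  then obtain O1 where O1: "open O1" "h ` (U - Z) = {y. 0 \<le> b \<bullet> y} \<inter> O1"
    by (metis openin_open)
  define y0 where "y0 = h p"
  have "y0 \<in> O1" and y0: "0 \<le> b \<bullet> y0"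
    using O1(2) U(2) p(2) y0_def by blast+
  then obtain r where r: "r > 0" "ball y0 r \<subseteq> O1"
    using O1(1) openE by blast
  define B where "B = {y. 0 \<le> b \<bullet> y} \<inter> ball y0 r"
  have BV: "B \<subseteq> h ` (U - Z)"
    using r(2) O1(2) B_def by blast
  have BV': "B \<subseteq> V"
    using BV hU by blast
  have "convex B"
    unfolding B_def by (simp add: convex_Int convex_halfspace_ge)
  \<comment> \<open>Half a radius in the inward direction \<open>b\<close> leads off the bounding
    hyperplane but not out of the ball, so \<open>B\<close> has interior points even if
    \<open>p\<close> is a boundary point.\<close>
  define y1 where "y1 = y0 + (r / (2 * norm b)) *\<^sub>R b"
  have "y1 \<in> ball y0 r"
    using r b by (simp add: y1_def dist_norm)
  moreover have "0 < b \<bullet> y1"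
    using y0 r b by (simp add: y1_def inner_add_right add_nonneg_pos)
  ultimately have "y1 \<in> {y. 0 < b \<bullet> y} \<inter> ball y0 r" by blast
  moreover have "open ({y. 0 < b \<bullet> y} \<inter> ball y0 r)"
    by (simp add: open_Int open_halfspace_gt)
  moreover have "{y. 0 < b \<bullet> y} \<inter> ball y0 r \<subseteq> B"
    unfolding B_def by auto
  ultimately have "interior B \<noteq> {}"
    by (metis empty_iff interior_maximal subsetD)
  then have "aff_dim B = int DIM('e)"
    by (rule aff_dim_nonempty_interior)
  then have "\<not> collinear B"
    using dim by (simp add: collinear_aff_dim)
  then have "connected (B - {y0})"
    using \<open>convex B\<close> by (simp add: connected_convex_diff_countable)
  then have con: "connected (g ` (B - {y0}))"
    using cg BV' by (intro connected_continuous_image) (auto intro: continuous_on_subset)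
  have "openin (top_of_set V) B"
  proof -
    have "V \<subseteq> {y. 0 \<le> b \<bullet> y}" using V openin_imp_subset by blast
    then have "B = V \<inter> ball y0 r" using BV' unfolding B_def by auto
    then show ?thesis by (simp add: openin_open_Int)
  qed
  then have "openin (top_of_set U) (g ` B)"
    using hg homeomorphism_imp_open_map homeomorphism_symD by blast
  then have W: "openin (top_of_set A) (g ` B)"
    using U(1) openin_trans by blast
  have "y0 \<in> B" using y0 r by (simp add: B_def)
  then have pW: "p \<in> g ` B"
    by (metis U(2) gh imageI y0_def)
  have gB: "g ` (B - {y0}) = g ` B - {p}"
  proof -
    have "g y = p \<Longrightarrow> y \<in> B \<Longrightarrow> y = y0" for y
      using hgy BV' y0_def by auto
    moreover have "g y0 = p" by (simp add: U(2) gh y0_def)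
    ultimately show ?thesis by auto
  qed
  have WZ: "g ` B \<inter> Z = {}"
    using BV gh by force
  have WA: "g ` B \<subseteq> A" using W openin_imp_subset by blast
  have "X \<inter> (g ` B - {p}) \<noteq> {}" "Y \<inter> (g ` B - {p}) \<noteq> {}"
    using X[OF W pW] Y[OF W pW] by blast+
  moreover have "g ` B - {p} \<subseteq> X \<union> Y" using WA cov WZ by blast
  moreover have "X \<inter> Y \<inter> (g ` B - {p}) = {}" using int WZ by blast
  ultimately show False
    using con cl unfolding gB connected_closed by blast
qed

text \<open>A connected set with more than one point has no isolated points, so infinitely many
  points of \<open>D\<close> are close to \<open>w\<close>, and only finitely many of them go to
  \<open>f w\<close>. This supplies the last two hypotheses of
  \<open>no_local_cut_point\<close>.\<close>

lemma image_accumulates: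
  fixes f :: "'b::metric_space \<Rightarrow> 'a::t2_space"
  assumes "connected D" "w \<in> D" "D \<noteq> {w}" "open N" "w \<in> N" "continuous_on D f"
    and fib: "finite {x \<in> D. f x = f w}"
    and W: "openin (top_of_set A) W" "f w \<in> W" "f ` D \<subseteq> A"
  shows "\<exists>x\<in>f ` (D \<inter> N) \<inter> W. x \<noteq> f w"
proof -
  obtain O1 where O1: "open O1" "W = A \<inter> O1"
    using W(1) unfolding openin_open by blast
  obtain O2 where O2: "open O2" "O2 \<inter> D = f -` O1 \<inter> D"
    using \<open>continuous_on D f\<close> O1(1) unfolding continuous_on_open_invariant by blast
  have "w islimpt D"
    using assms(1-3) by (intro connected_imp_perfect) auto
  moreover have "w \<in> O2 \<inter> N" "open (O2 \<inter> N)"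
    using O1 O2 W(2) assms(2,4,5) by (blast, simp add: open_Int)
  ultimately have "infinite (O2 \<inter> N \<inter> D)"
    unfolding islimpt_eq_acc_point by blast
  then have "\<not> O2 \<inter> N \<inter> D \<subseteq> {x \<in> D. f x = f w}"
    using fib finite_subset by blast
  then obtain x where "x \<in> D" "x \<in> O2" "x \<in> N" "f x \<noteq> f w" by blast
  then show ?thesis
    using O1 O2 W(3) by blast
qed

text \<open>Applied to a height function of a disk along an edge: by the intermediate value theorem
  its sign tells on which side of the single crossing a point of the edge lies.\<close>

lemma pos_iff_above_root:
  fixes f :: "real \<Rightarrow> real"
  assumes cont: "continuous_on {0..1} f" and "f 0 < 0" "f 1 > 0"
    and root: "\<And>x. 0 \<le> x \<Longrightarrow> x \<le> 1 \<Longrightarrow> f x = 0 \<Longrightarrow> x = r" "f r = 0"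
    and x: "0 \<le> x" "x \<le> 1"
  shows "f x > 0 \<longleftrightarrow> x > r"
proof
  assume fx: "f x > 0"
  have "continuous_on {0..x} f" by (rule continuous_on_subset[OF cont]) (use x in auto)
  then obtain z where z: "0 \<le> z" "z \<le> x" "f z = 0"
    using IVT'[of f 0 0 x] fx x \<open>f 0 < 0\<close> by auto
  then have "z = r" using root(1)[of z] x by linarith
  moreover have "z \<noteq> x" using z fx by auto
  ultimately show "x > r" using z by linarith
next
  assume xr: "x > r"
  show "f x > 0"
  proof (rule ccontr)
    assume fx: "\<not> f x > 0"
    have "continuous_on {x..1} f" by (rule continuous_on_subset[OF cont]) (use x in auto)
    then obtain z where z: "x \<le> z" "z \<le> 1" "f z = 0"
      using IVT'[of f x 0 1] fx x \<open>f 1 > 0\<close> by auto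
    then have "z = r" using root(1)[of z] x by linarith
    then show False using z xr by linarith
  qed
qed

section \<open>Normal disks in the tetrahedron\<close>

definition edge_pt :: "4 \<Rightarrow> 4 \<Rightarrow> real \<Rightarrow> real^4" where
  "edge_pt a b c = c *\<^sub>R corner a + (1 - c) *\<^sub>R corner b"

lemma edge_pt_nth: "edge_pt a b c $ l = (if l = a then c else 0) + (if l = b then 1 - c else 0)"
  by (auto simp: edge_pt_def axis_def)

lemma edge_pt_1 [simp]: "edge_pt a b 1 = corner a" and edge_pt_0 [simp]: "edge_pt a b 0 = corner b"
  by (auto simp: edge_pt_def)

lemma edge_pt_in_tetra: "0 \<le> c \<Longrightarrow> c \<le> 1 \<Longrightarrow> edge_pt a b c \<in> tetra"
  by (auto simp: tetra_def edge_pt_nth sum.distrib)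

lemma corner_in_tetra: "corner a \<in> tetra"
  using edge_pt_in_tetra[of 1 a a] by simp

lemma support_corner [simp]: "support (corner a) = {a}"
  by (auto simp: support_def axis_def)

lemma support_edge_pt: "0 < c \<Longrightarrow> c < 1 \<Longrightarrow> support (edge_pt a b c) = {a, b}"
  by (auto simp: support_def edge_pt_nth)

lemma edge_pt_in_face: "0 \<le> c \<Longrightarrow> c \<le> 1 \<Longrightarrow> a \<in> S \<Longrightarrow> b \<in> S \<Longrightarrow> edge_pt a b c \<in> face S"
  using edge_pt_in_tetra by (auto simp: face_def support_def edge_pt_nth split: if_splits)

lemma continuous_edge_pt: "continuous_on A (edge_pt a b)"
  unfolding edge_pt_def by (intro continuous_intros)

lemma tetra_nonneg: "x \<in> tetra \<Longrightarrow> 0 \<le> x $ l"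
  by (simp add: tetra_def)

lemma sum_support: "x \<in> tetra \<Longrightarrow> support x \<subseteq> S \<Longrightarrow> (\<Sum>i\<in>S. x $ i) = 1"
  by (subst sum.mono_neutral_left[of UNIV]) (auto simp: tetra_def support_def)

lemma tetra_two_support:
  assumes "x \<in> tetra" "support x = {a, b}" "a \<noteq> b"
  shows "x = edge_pt a b (x $ a)" "0 < x $ a" "x $ a < 1"
proof -
  have s: "x $ a + x $ b = 1"
    using sum_support[of x "{a, b}"] assms by simp
  have nz: "x $ l \<noteq> 0 \<longleftrightarrow> l \<in> {a, b}" for l
    using assms(2) by (auto simp: support_def)
  show "0 < x $ a" "x $ a < 1"
    using nz[of a] nz[of b] tetra_nonneg[OF assms(1), of a] tetra_nonneg[OF assms(1), of b] s by auto
  show "x = edge_pt a b (x $ a)"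
    unfolding vec_eq_iff edge_pt_nth using nz s assms(3) by (auto simp: algebra_simps)
qed

lemma tetra_one_support: "x \<in> tetra \<Longrightarrow> support x = {a} \<Longrightarrow> x = corner a"
  using sum_support[of x "{a}"] by (auto simp: vec_eq_iff axis_def support_def)

lemma tetra_UNIV_face: "tetra = face UNIV"
  by (auto simp: face_def)

lemma convex_tetra: "convex tetra"
  unfolding convex_def tetra_def
  by (auto simp: sum.distrib simp flip: sum_distrib_left)

lemma convex_face: "convex (face S)"
proof -
  have "face S = tetra \<inter> (\<Inter>l\<in>-S. {x. x $ l = 0})"
    by (auto simp: face_def support_def)
  moreover have "convex {x :: real^4. x $ l = 0}" for l
    by (auto simp: convex_def)
  ultimately show ?thesis
    using convex_tetra by (auto intro!: convex_Int convex_INT)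
qed

lemma compact_tetra: "compact tetra"
proof -
  have "tetra = (\<Inter>l. {x. 0 \<le> x $ l}) \<inter> {x. (\<Sum>i\<in>UNIV. x $ i) = 1}"
    by (auto simp: tetra_def)
  also have "closed \<dots>"
    by (intro closed_Int closed_INT closed_Collect_le closed_Collect_eq continuous_intros ballI)
  finally have "closed tetra" .
  moreover have "norm x \<le> 1" if "x \<in> tetra" for x
    using that norm_le_l1_cart[of x] by (simp add: tetra_def)
  then have "bounded tetra"
    by (auto simp: bounded_iff)
  ultimately show ?thesis by (simp add: compact_eq_bounded_closed)
qed

lemma permute_nth [simp]: "permute_coords \<pi> x $ l = x $ \<pi> l"
  by (simp add: permute_coords_def)

lemma permute_edge_pt: "inj \<pi> \<Longrightarrow> permute_coords \<pi> (edge_pt (\<pi> a) (\<pi> b) c) = edge_pt a b c"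
  by (auto simp: vec_eq_iff edge_pt_nth inj_eq)

lemma permute_corner: "inj \<pi> \<Longrightarrow> permute_coords \<pi> (corner (\<pi> a)) = corner a"
  by (auto simp: vec_eq_iff axis_def inj_eq)

lemma permute_in_tetra: "bij \<pi> \<Longrightarrow> x \<in> tetra \<Longrightarrow> permute_coords \<pi> x \<in> tetra"
  using sum.reindex_bij_betw[of \<pi> UNIV UNIV "\<lambda>i. x $ i"] by (auto simp: tetra_def)

lemma continuous_permute: "continuous_on A (permute_coords \<pi>)"
  unfolding permute_coords_def by (intro continuous_intros)

lemma ex_other: "\<exists>l::4. l \<noteq> a \<and> l \<noteq> b \<and> l \<noteq> c"
proof -
  have "card {a, b, c} \<le> 3"
    by (simp add: card_insert_if)
  then have "{a, b, c} \<noteq> (UNIV :: 4 set)"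
    by auto
  then show ?thesis by auto
qed

section \<open>Normal disks as level sets separating the corners\<close>

definition normal_map :: "(real^4 \<Rightarrow> real^4) \<Rightarrow> bool" where
  "normal_map g \<longleftrightarrow> (\<exists>g'. homeomorphism tetra tetra g g') \<and> (\<forall>S. g ` face S = face S)"

text \<open>A common form of both kinds of disks: \<open>A\<close> is the set of corners on one
  side, a singleton for a triangle and a pair for a quadrilateral.\<close>

definition normal_cut :: "4 set \<Rightarrow> (real^4) set \<Rightarrow> bool" where
  "normal_cut A D \<longleftrightarrow> (\<exists>g. normal_map g \<and> D = {x \<in> tetra. (\<Sum>a\<in>A. g x $ a) = 1/2})"

lemma normal_map_inj: "normal_map g \<Longrightarrow> inj_on g tetra"
  unfolding normal_map_def homeomorphism_def by (metis inj_on_inverseI)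

text \<open>The support is the least \<open>S\<close> with the point in \<open>face S\<close>, and
  injectivity turns the invariance of faces into an equivalence of membership.\<close>

lemma normal_map_support:
  assumes "normal_map g" "x \<in> tetra"
  shows "g x \<in> tetra" "support (g x) = support x"
proof -
  have im: "g ` face S = face S" for S
    using assms(1) by (simp add: normal_map_def)
  show gx: "g x \<in> tetra"
    using im[of UNIV] assms(2) unfolding tetra_UNIV_face by blast
  have "x \<in> face S \<longleftrightarrow> g x \<in> face S" for S
  proof
    assume "g x \<in> face S"
    then obtain y where y: "y \<in> face S" "g x = g y" using im[of S] by blast
    then have "x = y"
      using normal_map_inj[OF assms(1)] assms(2) by (auto simp: inj_on_def face_def)
    then show "x \<in> face S" using y by simp
  qed (use im in blast)
  then have "support x \<subseteq> S \<longleftrightarrow> support (g x) \<subseteq> S" for S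
    using assms(2) gx by (simp add: face_def)
  then show "support (g x) = support x" by blast
qed

lemma normally_isotopic_imp_normal_map:
  assumes "normally_isotopic D E"
  shows "\<exists>g. normal_map g \<and> D = {x \<in> tetra. g x \<in> E}"
proof -
  obtain H where "D \<subseteq> tetra" "normal_isotopy H" and E: "H 1 ` D = E"
    using assms unfolding normally_isotopic_def by blast
  then have g: "normal_map (H 1)"
    by (auto simp: normal_isotopy_def normal_map_def)
  then have "D = {x \<in> tetra. H 1 x \<in> E}"
    using normal_map_inj[OF g] \<open>D \<subseteq> tetra\<close> E by (auto simp: inj_on_def)
  then show ?thesis using g by blast
qed

lemma normal_triangle_cut:
  assumes "normal_triangle i D"
  shows "normal_cut {i} D"
proof -
  obtain g where g: "normal_map g" "D = {x \<in> tetra. g x \<in> {x \<in> tetra. x $ i = 1/2}}"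
    using assms normally_isotopic_imp_normal_map unfolding normal_triangle_def by blast
  then show ?thesis
    unfolding normal_cut_def using normal_map_support by (intro exI[of _ g]) auto
qed

lemma normal_quad_cut:
  assumes "normal_quad D"
  shows "\<exists>i j. i \<noteq> j \<and> normal_cut {i, j} D"
proof -
  obtain i j g where "i \<noteq> j" "normal_map g" "D = {x \<in> tetra. g x \<in> {x \<in> tetra. x $ i + x $ j = 1/2}}"
    using assms normally_isotopic_imp_normal_map unfolding normal_quad_def by blast
  then have "normal_cut {i, j} D"
    unfolding normal_cut_def using normal_map_support by (intro exI[of _ g]) auto
  then show ?thesis using \<open>i \<noteq> j\<close> by blast
qed

lemma normal_disk_cut: "normal_disk D \<Longrightarrow> \<exists>A. normal_cut A D"
  using normal_triangle_cut normal_quad_cut unfolding normal_disk_def by blast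

lemma normal_cut_subset: "normal_cut A D \<Longrightarrow> D \<subseteq> tetra"
  by (auto simp: normal_cut_def)

text \<open>The coordinates in \<open>A\<close> would sum to 0 if the support missed
  \<open>A\<close> and to 1 if it were contained in \<open>A\<close>, but on the disk they sum to
  1/2.\<close>

lemma normal_cut_support:
  assumes "normal_cut A D" "x \<in> D"
  shows "support x \<inter> A \<noteq> {}" "\<not> support x \<subseteq> A"
proof -
  obtain g where g: "normal_map g" "x \<in> tetra" "(\<Sum>a\<in>A. g x $ a) = 1/2"
    using assms by (auto simp: normal_cut_def)
  note s = normal_map_support[OF g(1,2)]
  show "\<not> support x \<subseteq> A"
    using sum_support[OF s(1), of A] s(2) g(3) by auto
  have "(\<Sum>a\<in>A. g x $ a) = 0" if "support x \<inter> A = {}"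
    using that unfolding s(2)[symmetric] by (intro sum.neutral) (auto simp: support_def)
  then show "support x \<inter> A \<noteq> {}" using g(3) by auto
qed

lemma sum_edge_pt: "(\<Sum>l\<in>A. edge_pt a b c $ l) = (if a \<in> A then c else 0) + (if b \<in> A then 1 - c else 0)"
  by (simp add: edge_pt_nth sum.distrib)

text \<open>If the ends of the edge lie on different sides, its midpoint is on the model disk, and
  the preimage of the midpoint under \<open>g\<close> stays in the open edge.\<close>

lemma normal_cut_edge_iff:
  assumes "normal_cut A D" "a \<noteq> b"
  shows "(\<exists>c. 0 < c \<and> c < 1 \<and> edge_pt a b c \<in> D) \<longleftrightarrow> (a \<in> A) \<noteq> (b \<in> A)"
proof
  assume "\<exists>c. 0 < c \<and> c < 1 \<and> edge_pt a b c \<in> D"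
  then obtain c where c: "0 < c" "c < 1" "edge_pt a b c \<in> D" by blast
  then show "(a \<in> A) \<noteq> (b \<in> A)"
    using normal_cut_support[OF assms(1) c(3)] by (auto simp: support_edge_pt)
next
  assume ab: "(a \<in> A) \<noteq> (b \<in> A)"
  obtain g where g: "normal_map g" "D = {x \<in> tetra. (\<Sum>a\<in>A. g x $ a) = 1/2}"
    using assms by (auto simp: normal_cut_def)
  have "edge_pt a b (1/2) \<in> g ` tetra"
    using g(1) edge_pt_in_tetra[of "1/2" a b] unfolding normal_map_def tetra_UNIV_face by auto
  then obtain x where x: "x \<in> tetra" "g x = edge_pt a b (1/2)" by auto
  have "support x = {a, b}"
    using normal_map_support[OF g(1) x(1)] x(2) by (simp add: support_edge_pt)
  moreover have "x \<in> D"
    using x ab by (auto simp: g(2) sum_edge_pt)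
  ultimately show "\<exists>c. 0 < c \<and> c < 1 \<and> edge_pt a b c \<in> D"
    using tetra_two_support[OF x(1) _ assms(2)] by metis
qed

text \<open>\<open>g\<close> sends every point of the disk on this open edge to the midpoint of the
  edge, and it is injective.\<close>

lemma normal_cut_edge_unique:
  assumes "normal_cut A D" "a \<noteq> b" "0 < c" "c < 1" "0 < c'" "c' < 1" "edge_pt a b c \<in> D" "edge_pt a b c' \<in> D"
  shows "c = c'"
proof -
  obtain g where g: "normal_map g" "D = {x \<in> tetra. (\<Sum>a\<in>A. g x $ a) = 1/2}"
    using assms by (auto simp: normal_cut_def)
  have ab: "(a \<in> A) \<noteq> (b \<in> A)"
    using normal_cut_edge_iff[OF assms(1,2)] assms by blast
  have *: "g (edge_pt a b d) = edge_pt a b (1/2)" if "0 < d" "d < 1" "edge_pt a b d \<in> D" for d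
  proof -
    have t: "edge_pt a b d \<in> tetra" using that normal_cut_subset[OF assms(1)] by auto
    define u where "u = g (edge_pt a b d) $ a"
    have u: "g (edge_pt a b d) = edge_pt a b u"
      unfolding u_def using normal_map_support[OF g(1) t] that
      by (intro tetra_two_support(1)[OF _ _ assms(2)]) (auto simp: support_edge_pt)
    then have "(\<Sum>l\<in>A. edge_pt a b u $ l) = 1/2"
      using that(3) g(2) by auto
    then have "u = 1/2" using ab by (auto simp: sum_edge_pt split: if_splits)
    then show ?thesis using u by blast
  qed
  have "g (edge_pt a b c) = g (edge_pt a b c')"
    using * assms by metis
  then have "edge_pt a b c = edge_pt a b c'"
    using normal_map_inj[OF g(1)] normal_cut_subset[OF assms(1)] assms by (auto simp: inj_on_def)
  then have "edge_pt a b c $ a = edge_pt a b c' $ a" by simp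
  then show ?thesis using assms(2) by (simp add: edge_pt_nth)
qed

text \<open>The normal map turns the intersection into a hyperplane section of a face, which is
  convex. With a triangular face this gives the arcs that gluings carry from one tetrahedron to the
  next.\<close>

lemma normal_cut_face_connected:
  assumes "normal_cut A D"
  shows "connected (D \<inter> face S)"
proof -
  obtain g where g: "normal_map g" "D = {x \<in> tetra. (\<Sum>a\<in>A. g x $ a) = 1/2}"
    using assms by (auto simp: normal_cut_def)
  obtain g' where g': "homeomorphism tetra tetra g g'"
    using g(1) by (auto simp: normal_map_def)
  define E where "E = {x. (\<Sum>a\<in>A. x $ a) = (1/2::real)} \<inter> face S"
  have Et: "E \<subseteq> tetra" by (auto simp: E_def face_def)
  have "D \<inter> face S = g' ` E"
  proof (intro equalityI subsetI)
    fix x assume x: "x \<in> D \<inter> face S"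
    then have "g x \<in> E"
      using g normal_map_support[OF g(1), of x] by (auto simp: E_def face_def)
    moreover have "g' (g x) = x"
      using x g' normal_cut_subset[OF assms] by (auto simp: homeomorphism_def)
    ultimately show "x \<in> g' ` E" by (metis imageI)
  next
    fix x assume "x \<in> g' ` E"
    then obtain y where y: "y \<in> E" "x = g' y" by auto
    then have x: "x \<in> tetra" "g x = y"
      using g' Et unfolding homeomorphism_def by blast+
    then show "x \<in> D \<inter> face S"
      using normal_map_support[OF g(1), of x] y(1) by (auto simp: g(2) E_def face_def)
  qed
  moreover have "convex E"
    unfolding E_def
  proof (intro convex_Int convex_face)
    show "convex {x :: real^4. (\<Sum>a\<in>A. x $ a) = 1/2}"
      unfolding convex_def
    proof safe
      fix x y :: "real^4" and u v :: real
      assume *: "(\<Sum>a\<in>A. x $ a) = 1/2" "(\<Sum>a\<in>A. y $ a) = 1/2" "u + v = 1"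
      have "u * (\<Sum>a\<in>A. x $ a) + v * (\<Sum>a\<in>A. y $ a) = 1/2"
        unfolding *(1,2) using *(3) by linarith
      then show "(\<Sum>a\<in>A. (u *\<^sub>R x + v *\<^sub>R y) $ a) = 1/2"
        by (simp add: sum.distrib sum_distrib_left)
    qed
  qed
  then have "connected E" by (rule convex_connected)
  then have "connected (g' ` E)"
    using g' Et by (intro connected_continuous_image) (auto simp: homeomorphism_def intro: continuous_on_subset)
  ultimately show ?thesis by simp
qed

lemma normal_cut_connected: "normal_cut A D \<Longrightarrow> connected D"
  using normal_cut_face_connected[of A D UNIV] normal_cut_subset[of A D] by (simp add: Int_absorb2 flip: tetra_UNIV_face)

text \<open>A signed height over the disk, namely the sum of the \<open>A\<close>-coordinates of
  \<open>g x\<close> minus 1/2, so that disjoint connected sets can be placed on one side of the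
  disk.\<close>

lemma normal_cut_height:
  assumes "normal_cut A D"
  shows "\<exists>h. continuous_on tetra h \<and> D = {x \<in> tetra. h x = (0::real)} \<and>
    (\<forall>x\<in>tetra. support x \<subseteq> A \<longrightarrow> h x > 0) \<and> (\<forall>x\<in>tetra. support x \<inter> A = {} \<longrightarrow> h x < 0)"
proof -
  obtain g where g: "normal_map g" "D = {x \<in> tetra. (\<Sum>a\<in>A. g x $ a) = 1/2}"
    using assms by (auto simp: normal_cut_def)
  define h where "h x = (\<Sum>a\<in>A. g x $ a) - 1/2" for x
  have "continuous_on tetra g"
    using g(1) by (auto simp: normal_map_def homeomorphism_def)
  then have "continuous_on tetra h"
    unfolding h_def by (intro continuous_intros)
  moreover have "h x > 0" if "x \<in> tetra" "support x \<subseteq> A" for x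
    using normal_map_support[OF g(1) that(1)] that sum_support[of "g x" A] by (simp add: h_def)
  moreover have "h x < 0" if "x \<in> tetra" "support x \<inter> A = {}" for x
  proof -
    have "(\<Sum>a\<in>A. g x $ a) = 0"
      using normal_map_support(2)[OF g(1) that(1)] that(2) by (intro sum.neutral) (auto simp: support_def)
    then show ?thesis by (simp add: h_def)
  qed
  moreover have "D = {x \<in> tetra. h x = 0}"
    by (simp add: g(2) h_def)
  ultimately show ?thesis by blast
qed

lemma normal_cut_compact:
  assumes "normal_cut A D"
  shows "compact D"
proof -
  obtain h :: "real^4 \<Rightarrow> real" where h: "continuous_on tetra h" "D = {x \<in> tetra. h x = 0}"
    using normal_cut_height[OF assms] by blast
  have "closedin (top_of_set tetra) D"
    unfolding h(2) by (rule continuous_closedin_preimage_constant[OF h(1)])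
  then show ?thesis
    using compact_tetra closedin_compact by blast
qed

text \<open>The corner linked by a triangle is an end of every edge that the triangle meets, and
  \<open>i\<close> is the only common end of the two edges.\<close>

lemma normal_disk_two_edges:
  assumes "normal_disk D" "i \<noteq> j" "i \<noteq> l" "j \<noteq> l" "0 < c" "c < 1" "edge_pt i j c \<in> D" "0 < d" "d < 1" "edge_pt i l d \<in> D"
  shows "normal_triangle i D \<or> normal_quad D"
proof -
  have "a = i" if "normal_triangle a D" for a
    using normal_cut_edge_iff[OF normal_triangle_cut[OF that]] assms by (metis singletonD singletonI)
  then show ?thesis using assms(1) unfolding normal_disk_def by blast
qed

text \<open>A disk missing the face opposite to \<open>i\<close> meets only edges ending at
  \<open>i\<close>. The edges met by a quadrilateral have no common end, and those met by a triangle
  have only the linked corner in common.\<close>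

lemma normal_disk_all_support:
  assumes "normal_disk D" "\<And>x. x \<in> D \<Longrightarrow> i \<in> support x"
  shows "normal_triangle i D"
proof -
  have meets: "a = i \<or> b = i" if "normal_cut A D" "a \<in> A" "b \<notin> A" for A a b
  proof -
    have "a \<noteq> b" using that by auto
    then have "\<exists>c>0. c < 1 \<and> edge_pt a b c \<in> D"
      using that normal_cut_edge_iff[OF that(1), of a b] by blast
    then show ?thesis using assms(2) by (force simp: support_edge_pt)
  qed
  show ?thesis
  proof (cases "normal_quad D")
    case True
    then obtain a b where ab: "a \<noteq> b" "normal_cut {a, b} D" using normal_quad_cut by blast
    obtain c where c: "c \<noteq> a" "c \<noteq> b" "c \<noteq> i" using ex_other by metis
    have "a = i" "b = i" using meets[OF ab(2), of _ c] c by auto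
    then show ?thesis using ab by simp
  next
    case False
    then obtain a where a: "normal_triangle a D" using assms(1) by (auto simp: normal_disk_def)
    obtain c where c: "c \<noteq> a" "c \<noteq> i" using ex_other by metis
    have "a = i" using meets[OF normal_triangle_cut[OF a], of a c] c by auto
    then show ?thesis using a by simp
  qed
qed

lemma normal_triangle_unique:
  assumes "normal_triangle i D" "normal_triangle j D"
  shows "i = j"
proof (rule ccontr)
  assume "i \<noteq> j"
  obtain l where l: "l \<noteq> i" "l \<noteq> j" using ex_other by metis
  then show False
    using \<open>i \<noteq> j\<close> normal_cut_edge_iff[OF normal_triangle_cut[OF assms(1)], of j l]
      normal_cut_edge_iff[OF normal_triangle_cut[OF assms(2)], of j l] by auto
qed

lemma normal_triangle_support:
  assumes "normal_triangle i D" "x \<in> D"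
  shows "i \<in> support x" "support x \<noteq> {i}"
  using normal_cut_support[OF normal_triangle_cut[OF assms(1)] assms(2)] by auto

text \<open>A disk that is closer to the corner \<open>i\<close> than a disjoint triangle linking \<open>i\<close> along one edge misses the face opposite to \<open>i\<close>, hence is itself a triangle linking \<open>i\<close>.\<close>

lemma normal_triangle_closer:
  assumes D: "normal_triangle i D" and E: "normal_disk E" "D \<inter> E = {}"
    and ij: "i \<noteq> j" "0 < c" "c < 1" "edge_pt i j c \<in> D" "c < c'" "c' < 1" "edge_pt i j c' \<in> E"
    and il: "i \<noteq> l" "0 < d" "d < 1" "edge_pt i l d \<in> D"
  shows "normal_triangle i E" "\<exists>d'>d. d' < 1 \<and> edge_pt i l d' \<in> E"
proof -
  obtain h :: "real^4 \<Rightarrow> real" where h: "continuous_on tetra h" "D = {x \<in> tetra. h x = 0}"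
    and pos: "\<And>x. x \<in> tetra \<Longrightarrow> support x \<subseteq> {i} \<Longrightarrow> h x > 0"
    and neg: "\<And>x. x \<in> tetra \<Longrightarrow> support x \<inter> {i} = {} \<Longrightarrow> h x < 0"
    using normal_cut_height[OF normal_triangle_cut[OF D]] by blast
  \<comment> \<open>Along each edge at \<open>i\<close> the height vanishes only at the point of
    \<open>D\<close>, so its sign compares parameters.\<close>
  have above: "h (edge_pt i k x) > 0 \<longleftrightarrow> x > r"
    if "i \<noteq> k" "0 < r" "r < 1" "edge_pt i k r \<in> D" "0 \<le> x" "x \<le> 1" for k r x
  proof (rule pos_iff_above_root[of "\<lambda>x. h (edge_pt i k x)"])
    show "continuous_on {0..1} (\<lambda>x. h (edge_pt i k x))"
      using h(1) edge_pt_in_tetra by (intro continuous_on_compose2[OF h(1) continuous_edge_pt]) auto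
    have k: "h (corner k) < 0" using neg[OF corner_in_tetra, of k] that by auto
    then show "h (edge_pt i k 0) < 0" by simp
    have i: "h (corner i) > 0" using pos[OF corner_in_tetra, of i] by auto
    then show "0 < h (edge_pt i k 1)" by simp
    show "h (edge_pt i k r) = 0" using that h(2) by simp
    fix y assume y: "0 \<le> y" "y \<le> 1" "h (edge_pt i k y) = 0"
    then have "y \<noteq> 0" "y \<noteq> 1" using k i by auto
    moreover have "edge_pt i k y \<in> D" using y h(2) edge_pt_in_tetra by simp
    ultimately show "y = r"
      using normal_cut_edge_unique[OF normal_triangle_cut[OF D], of i k y r] y that by auto
  qed (use that in auto)
  obtain A where A: "normal_cut A E" using normal_disk_cut E(1) by blast
  have Et: "E \<subseteq> tetra" using normal_cut_subset[OF A] .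
  have "connected (h ` E)"
    using normal_cut_connected[OF A] h(1) Et by (intro connected_continuous_image) (auto intro: continuous_on_subset)
  moreover have "0 \<notin> h ` E" using E(2) h(2) Et by auto
  moreover have hc: "h (edge_pt i j c') > 0" using above[of j c c'] ij by auto
  \<comment> \<open>\<open>E\<close> is connected and avoids the zero set of \<open>h\<close>, so
    the sign at its known point on the edge \<open>ij\<close> is the sign everywhere on
    \<open>E\<close>.\<close>
  ultimately have hpos: "h x > 0" if "x \<in> E" for x
    using that ij(7) connectedD_interval[of "h ` E" "h x" "h (edge_pt i j c')" 0]
    by (metis imageI linorder_not_less order_less_imp_le)
  show tri: "normal_triangle i E"
  proof (rule normal_disk_all_support[OF E(1)])
    fix x assume "x \<in> E"
    then show "i \<in> support x" using hpos[of x] neg[of x] Et by force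
  qed
  obtain d' where d': "0 < d'" "d' < 1" "edge_pt i l d' \<in> E"
    using normal_cut_edge_iff[OF normal_triangle_cut[OF tri] il(1)] il(1) by auto
  then show "\<exists>d'>d. d' < 1 \<and> edge_pt i l d' \<in> E"
    using above[of l d d'] il hpos by auto
qed

text \<open>The points whose two largest coordinates are those of \<open>a\<close> and \<open>b\<close>. Unlike open stars, these
  neighbourhoods of different edges are disjoint, and permutations of the vertices respect them.\<close>

definition edge_nbhd :: "4 \<Rightarrow> 4 \<Rightarrow> (real^4) set" where
  "edge_nbhd a b = {x. \<forall>l. l \<noteq> a \<longrightarrow> l \<noteq> b \<longrightarrow> x $ l < x $ a \<and> x $ l < x $ b}"

text \<open>The variant from which \<open>edge_step\<close> builds its closed sets \<open>X\<close>
  and \<open>Y\<close>; points in it but in no relevant open neighbourhood fall into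
  \<open>Z\<close> there.\<close>

definition closed_edge_nbhd :: "4 \<Rightarrow> 4 \<Rightarrow> (real^4) set" where
  "closed_edge_nbhd a b = {x. \<forall>l. l \<noteq> a \<longrightarrow> l \<noteq> b \<longrightarrow> x $ l \<le> x $ a \<and> x $ l \<le> x $ b}"

lemma open_edge_nbhd: "open (edge_nbhd a b)"
proof -
  have "edge_nbhd a b = (\<Inter>l\<in>-{a, b}. {x. x $ l < x $ a} \<inter> {x. x $ l < x $ b})"
    by (auto simp: edge_nbhd_def)
  also have "open \<dots>"
    by (intro open_INT open_Int open_Collect_less ballI continuous_intros) auto
  finally show ?thesis .
qed

lemma closed_closed_edge_nbhd: "closed (closed_edge_nbhd a b)"
proof -
  have "closed_edge_nbhd a b = (\<Inter>l\<in>-{a, b}. {x. x $ l \<le> x $ a} \<inter> {x. x $ l \<le> x $ b})"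
    by (auto simp: closed_edge_nbhd_def)
  also have "closed \<dots>"
    by (intro closed_INT closed_Int closed_Collect_le ballI continuous_intros)
  finally show ?thesis .
qed

lemma edge_nbhd_subset_closed: "edge_nbhd a b \<subseteq> closed_edge_nbhd a b"
  by (auto simp: edge_nbhd_def closed_edge_nbhd_def order_less_imp_le)

lemma edge_nbhd_swap: "edge_nbhd a b = edge_nbhd b a"
  by (auto simp: edge_nbhd_def)

lemma edge_pt_in_nbhd: "0 < c \<Longrightarrow> c < 1 \<Longrightarrow> a \<noteq> b \<Longrightarrow> edge_pt a b c \<in> edge_nbhd a b"
  by (auto simp: edge_nbhd_def edge_pt_nth)

text \<open>If \<open>a\<close> were neither \<open>d\<close> nor \<open>e\<close>, its coordinate
  would be strictly below both of theirs. But one of \<open>d\<close>, \<open>e\<close> is off the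
  edge \<open>ab\<close>, so its coordinate is at most that of \<open>a\<close>. The same holds for
  \<open>b\<close>.\<close>

lemma edge_nbhds_meet:
  assumes "x \<in> closed_edge_nbhd a b" "x \<in> edge_nbhd d e" "a \<noteq> b" "d \<noteq> e"
  shows "{a, b} = {d, e}"
proof -
  have "a = d \<or> a = e"
  proof (rule ccontr)
    assume "\<not> ?thesis"
    then have a: "x $ a < x $ d" "x $ a < x $ e" using assms(2) by (auto simp: edge_nbhd_def)
    then have "d \<noteq> a" "e \<noteq> a" by auto
    then have "d \<noteq> b \<or> e \<noteq> b" using assms(4) by auto
    then have "x $ d \<le> x $ a \<or> x $ e \<le> x $ a"
      using assms(1) \<open>d \<noteq> a\<close> \<open>e \<noteq> a\<close> unfolding closed_edge_nbhd_def by blast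
    then show False using a by linarith
  qed
  moreover have "b = d \<or> b = e"
  proof (rule ccontr)
    assume "\<not> ?thesis"
    then have a: "x $ b < x $ d" "x $ b < x $ e" using assms(2) by (auto simp: edge_nbhd_def)
    then have "d \<noteq> b" "e \<noteq> b" by auto
    then have "d \<noteq> a \<or> e \<noteq> a" using assms(4) by auto
    then have "x $ d \<le> x $ b \<or> x $ e \<le> x $ b"
      using assms(1) \<open>d \<noteq> b\<close> \<open>e \<noteq> b\<close> unfolding closed_edge_nbhd_def by blast
    then show False using a by linarith
  qed
  ultimately show ?thesis using assms(3) by auto
qed

lemma edge_nbhd_support:
  assumes "x \<in> tetra" "x \<in> edge_nbhd a b"
  shows "a \<in> support x" "b \<in> support x"
proof -
  obtain l where "l \<noteq> a" "l \<noteq> b" using ex_other[of a b b] by metis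
  then have "x $ l < x $ a" "x $ l < x $ b" using assms(2) by (auto simp: edge_nbhd_def)
  then show "a \<in> support x" "b \<in> support x"
    using tetra_nonneg[OF assms(1), of l] by (auto simp: support_def)
qed

lemma UNIV_4_distinct:
  assumes "distinct [a, b, l, m :: 4]"
  shows "UNIV = {a, b, l, m}"
proof -
  have "card {a, b, l, m} = 4" using assms by auto
  then show ?thesis using card_subset_eq[of UNIV "{a, b, l, m}"] by simp
qed

section \<open>Levels of normal triangles\<close>

locale normal_in_triangulation =
  fixes M F :: "'a::t2_space set" and I :: "'i set" and \<phi> :: "'i \<Rightarrow> real^4 \<Rightarrow> 'a"
  assumes compact_3: "compact_3_manifold M"
    and triangulation: "pseudo_triangulation M I \<phi>"
    and normal: "normal_surface M I \<phi> F"
begin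

text \<open>Mind the direction: \<open>permute_coords \<pi>\<close> sends corner
  \<open>\<pi> a\<close> to corner \<open>a\<close>, so \<open>\<pi>\<close> leads from the corners
  of \<open>t\<close> back to those of \<open>s\<close>.\<close>

definition glues :: "'i \<Rightarrow> 'i \<Rightarrow> (4 \<Rightarrow> 4) \<Rightarrow> 4 set \<Rightarrow> bool" where
  "glues s t \<pi> S \<longleftrightarrow> bij \<pi> \<and> (\<forall>z\<in>face S. \<phi> t (permute_coords \<pi> z) = \<phi> s z)"

text \<open>An identification of directed edges that keeps the parameter, so that levels and the
  vertex at the first end are transferred.\<close>

definition same_edge :: "'i \<Rightarrow> 4 \<Rightarrow> 4 \<Rightarrow> 'i \<Rightarrow> 4 \<Rightarrow> 4 \<Rightarrow> bool" where
  "same_edge s i j t a b \<longleftrightarrow> (\<forall>c. 0 \<le> c \<and> c \<le> 1 \<longrightarrow> \<phi> s (edge_pt i j c) = \<phi> t (edge_pt a b c))"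

abbreviation piece :: "'i \<Rightarrow> real^4 \<Rightarrow> (real^4) set" where
  "piece s x \<equiv> connected_component_set (trace \<phi> F s) x"

text \<open>The parameter is the weight of \<open>a\<close>, so larger values are nearer to
  \<open>a\<close>. The strict bounds leave out the starting point and the corner.\<close>

definition level :: "'i \<Rightarrow> 4 \<Rightarrow> 4 \<Rightarrow> real \<Rightarrow> nat" where
  "level s a b c = card {c'. c < c' \<and> c' < 1 \<and> \<phi> s (edge_pt a b c') \<in> F}"

text \<open>The level is prescribed on all edges at \<open>i\<close>; \<open>triangle_atI\<close>
  obtains this from a single edge.\<close>

definition triangle_at :: "'i \<Rightarrow> 4 \<Rightarrow> nat \<Rightarrow> (real^4) set \<Rightarrow> bool" where
  "triangle_at s i k D \<longleftrightarrow> s \<in> I \<and> D \<in> pieces \<phi> F s \<and> normal_triangle i D \<and>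
     (\<forall>j c. i \<noteq> j \<and> 0 < c \<and> c < 1 \<and> edge_pt i j c \<in> D \<longrightarrow> level s i j c = k)"

text \<open>The quadrilateral \<open>Q\<close> meets the face opposite to the corner \<open>m\<close> in an arc that cuts off a corner
  lying at \<open>v\<close> and has exactly \<open>k\<close> arcs of the surface between itself and that corner.\<close>

definition quad_arc_at :: "'i \<Rightarrow> (real^4) set \<Rightarrow> 4 \<Rightarrow> 'a \<Rightarrow> nat \<Rightarrow> bool" where
  "quad_arc_at s Q m v k \<longleftrightarrow> s \<in> I \<and> Q \<in> pieces \<phi> F s \<and> normal_quad Q \<and>
     (\<exists>a b d x y. distinct [a, b, d, m] \<and> 0 < x \<and> x < 1 \<and> 0 < y \<and> y < 1 \<and>
        edge_pt a b x \<in> Q \<and> edge_pt a d y \<in> Q \<and> v = \<phi> s (corner a) \<and>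
        level s a b x = k \<and> level s a d y = k)"

lemma triangle_atD:
  assumes "triangle_at s i k D"
  shows "s \<in> I" "D \<in> pieces \<phi> F s" "normal_triangle i D"
    "i \<noteq> j \<Longrightarrow> 0 < c \<Longrightarrow> c < 1 \<Longrightarrow> edge_pt i j c \<in> D \<Longrightarrow> level s i j c = k"
  using assms unfolding triangle_at_def by blast+

section \<open>Gluings, identified edges and fibres of the characteristic maps\<close>

lemma triangulation_facts:
  shows finite_I: "finite I"
    and continuous_charts: "\<forall>s\<in>I. continuous_on tetra (\<phi> s)"
    and M_eq: "M = (\<Union>s\<in>I. \<phi> s ` tetra)"
    and inj_open_faces: "\<forall>s\<in>I. \<forall>S. inj_on (\<phi> s) (open_face S)"
    and interiors: "\<forall>s\<in>I. \<forall>t\<in>I. \<forall>x\<in>open_face UNIV. \<forall>y\<in>tetra. \<phi> s x = \<phi> t y \<longrightarrow> s = t \<and> x = y"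
    and gluings: "\<forall>s\<in>I. \<forall>t\<in>I. \<forall>x\<in>tetra. \<forall>y\<in>tetra. \<phi> s x = \<phi> t y \<longrightarrow>
        (\<exists>\<pi>. bij \<pi> \<and> y = permute_coords \<pi> x \<and>
             (\<forall>z\<in>face (support x). \<phi> t (permute_coords \<pi> z) = \<phi> s z))"
proof -
  note p = triangulation[unfolded pseudo_triangulation_def]
  show "finite I"
    and "\<forall>s\<in>I. continuous_on tetra (\<phi> s)"
    and "M = (\<Union>s\<in>I. \<phi> s ` tetra)"
    and "\<forall>s\<in>I. \<forall>S. inj_on (\<phi> s) (open_face S)"
    and "\<forall>s\<in>I. \<forall>t\<in>I. \<forall>x\<in>open_face UNIV. \<forall>y\<in>tetra. \<phi> s x = \<phi> t y \<longrightarrow> s = t \<and> x = y"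
    and "\<forall>s\<in>I. \<forall>t\<in>I. \<forall>x\<in>tetra. \<forall>y\<in>tetra. \<phi> s x = \<phi> t y \<longrightarrow>
        (\<exists>\<pi>. bij \<pi> \<and> y = permute_coords \<pi> x \<and>
             (\<forall>z\<in>face (support x). \<phi> t (permute_coords \<pi> z) = \<phi> s z))"
    by (insert p, elim conjE, assumption)+
qed

lemma continuous_chart: "s \<in> I \<Longrightarrow> continuous_on tetra (\<phi> s)"
  using continuous_charts by simp

lemma inj_open_face: "s \<in> I \<Longrightarrow> inj_on (\<phi> s) (open_face S)"
  using inj_open_faces by simp

lemma interior_disjoint:
  "s \<in> I \<Longrightarrow> t \<in> I \<Longrightarrow> x \<in> tetra \<Longrightarrow> support x = UNIV \<Longrightarrow> y \<in> tetra \<Longrightarrow> \<phi> s x = \<phi> t y \<Longrightarrow> s = t \<and> x = y"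
  using interiors by (simp add: open_face_def)

lemma glue:
  assumes "s \<in> I" "t \<in> I" "x \<in> tetra" "y \<in> tetra" "\<phi> s x = \<phi> t y"
  obtains \<pi> where "bij \<pi>" "y = permute_coords \<pi> x" "glues s t \<pi> (support x)"
proof -
  have "\<exists>\<pi>. bij \<pi> \<and> y = permute_coords \<pi> x \<and>
      (\<forall>z\<in>face (support x). \<phi> t (permute_coords \<pi> z) = \<phi> s z)"
    using gluings assms by simp
  then show ?thesis using that unfolding glues_def by blast
qed

lemma glues_same_edge:
  assumes "glues s t \<pi> S" "\<pi> a \<in> S" "\<pi> b \<in> S"
  shows "same_edge s (\<pi> a) (\<pi> b) t a b"
  unfolding same_edge_def
proof (intro allI impI)
  fix c :: real assume "0 \<le> c \<and> c \<le> 1"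
  then have "edge_pt (\<pi> a) (\<pi> b) c \<in> face S" using edge_pt_in_face assms by simp
  then have "\<phi> t (permute_coords \<pi> (edge_pt (\<pi> a) (\<pi> b) c)) = \<phi> s (edge_pt (\<pi> a) (\<pi> b) c)"
    using assms(1) by (simp add: glues_def)
  moreover have "inj \<pi>" using assms(1) bij_is_inj by (auto simp: glues_def)
  ultimately show "\<phi> s (edge_pt (\<pi> a) (\<pi> b) c) = \<phi> t (edge_pt a b c)" by (simp add: permute_edge_pt)
qed

lemma same_edge_trans: "same_edge s i j t a b \<Longrightarrow> same_edge t a b u d e \<Longrightarrow> same_edge s i j u d e"
  by (auto simp: same_edge_def)

lemma same_edge_corner: "same_edge s i j t a b \<Longrightarrow> \<phi> s (corner i) = \<phi> t (corner a)"
  unfolding same_edge_def by (metis edge_pt_1 order_refl zero_le_one)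

text \<open>No edge is folded onto itself: the parameter 1/3, unlike 1/2, is moved by a reversal,
  which would give two points of one open edge with the same image.\<close>

lemma same_edge_not_reversed:
  assumes "t \<in> I" "a \<noteq> b" "same_edge s i j t a b"
  shows "\<not> same_edge s i j t b a"
proof
  assume "same_edge s i j t b a"
  then have "\<phi> t (edge_pt a b (1/3)) = \<phi> t (edge_pt b a (1/3))"
    using assms(3) by (auto simp: same_edge_def)
  moreover have "edge_pt a b (1/3) \<in> open_face {a, b}" "edge_pt b a (1/3) \<in> open_face {a, b}"
    by (auto simp: open_face_def edge_pt_in_tetra support_edge_pt)
  ultimately have "edge_pt a b (1/3) $ a = edge_pt b a (1/3) $ a"
    using inj_open_face[OF assms(1), of "{a, b}"] by (metis inj_onD)
  then show False using assms(2) by (simp add: edge_pt_nth)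
qed

lemma same_edge_level: "same_edge s i j t a b \<Longrightarrow> 0 \<le> c \<Longrightarrow> level s i j c = level t a b c"
  unfolding level_def same_edge_def by (intro arg_cong[of _ _ card]) auto

text \<open>The gluing at an interior point of an edge identifies the whole edge and only permutes
  coordinates, so the parameter \<open>c\<close> survives.\<close>

lemma edge_fibre:
  assumes "s \<in> I" "t \<in> I" "i \<noteq> j" "0 < c" "c < 1" "x \<in> tetra" "\<phi> s (edge_pt i j c) = \<phi> t x"
  shows "\<exists>a b. a \<noteq> b \<and> same_edge s i j t a b \<and> x = edge_pt a b c"
proof -
  have "edge_pt i j c \<in> tetra" using assms by (simp add: edge_pt_in_tetra)
  then obtain \<pi> where \<pi>: "bij \<pi>" "x = permute_coords \<pi> (edge_pt i j c)" "glues s t \<pi> {i, j}"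
    using assms by (metis glue support_edge_pt)
  obtain a b where ab: "i = \<pi> a" "j = \<pi> b" using \<pi>(1) by (metis bij_pointE)
  then have "a \<noteq> b" "same_edge s i j t a b" "x = edge_pt a b c"
    using \<pi> assms(3) glues_same_edge[OF \<pi>(3), of a b] permute_edge_pt[OF bij_is_inj[OF \<pi>(1)]] by auto
  then show ?thesis by blast
qed

text \<open>Points with the same image differ by one of finitely many permutations of the
  coordinates.\<close>

lemma finite_fibre:
  assumes "s \<in> I" "t \<in> I" "x \<in> tetra"
  shows "finite {y \<in> tetra. \<phi> s x = \<phi> t y}"
proof (rule finite_subset)
  show "{y \<in> tetra. \<phi> s x = \<phi> t y} \<subseteq> (\<lambda>\<pi>. permute_coords \<pi> x) ` UNIV"
  proof
    fix y assume "y \<in> {y \<in> tetra. \<phi> s x = \<phi> t y}"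
    then obtain \<pi> where "y = permute_coords \<pi> x" using glue[OF assms, of y] by blast
    then show "y \<in> (\<lambda>\<pi>. permute_coords \<pi> x) ` UNIV" by simp
  qed
qed simp

section \<open>Pieces of the surface in a tetrahedron\<close>

lemma finite_pieces: "s \<in> I \<Longrightarrow> finite (pieces \<phi> F s)"
  and piece_disk: "s \<in> I \<Longrightarrow> D \<in> pieces \<phi> F s \<Longrightarrow> normal_disk D"
  using normal by (simp_all add: normal_surface_def)

lemma piece_cut: "s \<in> I \<Longrightarrow> D \<in> pieces \<phi> F s \<Longrightarrow> \<exists>A. normal_cut A D"
  using piece_disk normal_disk_cut by blast

lemma pieces_subset: "D \<in> pieces \<phi> F s \<Longrightarrow> D \<subseteq> trace \<phi> F s"
  unfolding pieces_def by (rule in_components_subset)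

lemma piece_mem: "x \<in> trace \<phi> F s \<Longrightarrow> piece s x \<in> pieces \<phi> F s \<and> x \<in> piece s x"
  by (simp add: pieces_def componentsI connected_component_refl_eq)

lemma piece_eq: "D \<in> pieces \<phi> F s \<Longrightarrow> x \<in> D \<Longrightarrow> piece s x = D"
  unfolding pieces_def by (erule componentsE) (simp only: connected_component_eq)

lemma connected_subset_piece: "connected C \<Longrightarrow> C \<subseteq> trace \<phi> F s \<Longrightarrow> x \<in> C \<Longrightarrow> C \<subseteq> piece s x"
  by (rule connected_component_maximal)

lemma trace_edge: "0 \<le> c \<Longrightarrow> c \<le> 1 \<Longrightarrow> edge_pt a b c \<in> trace \<phi> F s \<longleftrightarrow> \<phi> s (edge_pt a b c) \<in> F"
  by (simp add: trace_def edge_pt_in_tetra)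

lemma piece_image:
  assumes "s \<in> I" "D \<in> pieces \<phi> F s"
  shows "compact (\<phi> s ` D)" "connected (\<phi> s ` D)" "\<phi> s ` D \<subseteq> F"
proof -
  obtain A where A: "normal_cut A D" using piece_cut assms by blast
  have "continuous_on D (\<phi> s)"
    using continuous_chart[OF assms(1)] normal_cut_subset[OF A] continuous_on_subset by blast
  then show "compact (\<phi> s ` D)" "connected (\<phi> s ` D)"
    using normal_cut_compact[OF A] normal_cut_connected[OF A] by (auto intro: compact_continuous_image connected_continuous_image)
  show "\<phi> s ` D \<subseteq> F" using pieces_subset[OF assms(2)] by (auto simp: trace_def)
qed

lemma surface: "manifold_with_boundary TYPE(real^2) F"
  using normal by (simp add: normal_surface_def properly_embedded_surface_def)

lemma F_subset: "F \<subseteq> M"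
  using normal closedin_imp_subset[of euclidean M F]
  by (simp add: normal_surface_def properly_embedded_surface_def)

lemma F_covered:
  assumes "q \<in> F"
  obtains s x where "s \<in> I" "x \<in> trace \<phi> F s" "q = \<phi> s x"
proof -
  obtain s x where "s \<in> I" "x \<in> tetra" "q = \<phi> s x"
    using assms F_subset M_eq by blast
  then show ?thesis using that assms by (simp add: trace_def)
qed

text \<open>Different points of the surface on one open edge lie in different pieces.\<close>

lemma finite_level_set:
  assumes "s \<in> I" "a \<noteq> b" "0 \<le> c"
  shows "finite {c'. c < c' \<and> c' < 1 \<and> \<phi> s (edge_pt a b c') \<in> F}" (is "finite ?L")
proof (rule inj_on_finite)
  let ?f = "\<lambda>c'. piece s (edge_pt a b c')"
  have t: "edge_pt a b c' \<in> trace \<phi> F s" if "c' \<in> ?L" for c'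
    using that assms(3) by (simp add: trace_edge)
  show "?f ` ?L \<subseteq> pieces \<phi> F s" using t piece_mem by blast
  show "inj_on ?f ?L"
  proof (rule inj_onI)
    fix x y assume xy: "x \<in> ?L" "y \<in> ?L" "?f x = ?f y"
    then have "edge_pt a b x \<in> ?f x" "edge_pt a b y \<in> ?f x" "?f x \<in> pieces \<phi> F s"
      using t piece_mem by blast+
    moreover obtain A where "normal_cut A (?f x)" using piece_cut[OF assms(1)] calculation(3) by blast
    ultimately show "x = y"
      using normal_cut_edge_unique[of A "?f x" a b x y] assms xy by auto
  qed
  show "finite (pieces \<phi> F s)" using finite_pieces assms by blast
qed

text \<open>By \<open>normal_triangle_closer\<close>, the piece through a point of the edge
  \<open>ij\<close> beyond \<open>D\<close> also crosses the edge \<open>il\<close> beyond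
  \<open>D\<close>. Sending one crossing to the other is injective, since a piece crosses
  \<open>ij\<close> only once. Exchanging the edges gives equality.\<close>

lemma triangle_level_le:
  assumes s: "s \<in> I" and D: "D \<in> pieces \<phi> F s" "normal_triangle i D"
    and ij: "i \<noteq> j" "0 < c" "c < 1" "edge_pt i j c \<in> D"
    and il: "i \<noteq> l" "0 < d" "d < 1" "edge_pt i l d \<in> D"
  shows "level s i j c \<le> level s i l d"
proof -
  define L where "L = {c'. c < c' \<and> c' < 1 \<and> \<phi> s (edge_pt i j c') \<in> F}"
  define R where "R = {c'. d < c' \<and> c' < 1 \<and> \<phi> s (edge_pt i l c') \<in> F}"
  have t: "edge_pt i j c' \<in> trace \<phi> F s" if "c' \<in> L" for c'
    using that ij by (simp add: L_def trace_edge)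
  have "\<forall>c'\<in>L. \<exists>d'>d. d' < 1 \<and> edge_pt i l d' \<in> piece s (edge_pt i j c')"
  proof
    fix c' assume c': "c' \<in> L"
    let ?E = "piece s (edge_pt i j c')"
    have E: "?E \<in> pieces \<phi> F s" "edge_pt i j c' \<in> ?E" using piece_mem[OF t[OF c']] by blast+
    have "edge_pt i j c' \<notin> D"
      using normal_cut_edge_unique[OF normal_triangle_cut[OF D(2)] ij(1), of c c'] ij c' by (auto simp: L_def)
    then have "D \<inter> ?E = {}"
      using piece_eq[OF D(1)] piece_eq[OF E(1)] E(2) by blast
    then show "\<exists>d'>d. d' < 1 \<and> edge_pt i l d' \<in> ?E"
      using c' by (intro normal_triangle_closer(2)[OF D(2) piece_disk[OF s E(1)] _ ij _ _ E(2) il]) (auto simp: L_def)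
  qed
  from bchoice[OF this] obtain f where
    f: "\<And>c'. c' \<in> L \<Longrightarrow> d < f c' \<and> f c' < 1 \<and> edge_pt i l (f c') \<in> piece s (edge_pt i j c')"
    by blast
  have "card L \<le> card R"
  proof (rule card_inj_on_le)
    show "f ` L \<subseteq> R"
    proof (intro image_subsetI)
      fix c' assume c': "c' \<in> L"
      have "edge_pt i l (f c') \<in> trace \<phi> F s"
        using f[OF c'] by (meson connected_component_subset subsetD)
      then show "f c' \<in> R" using f[OF c'] by (simp add: R_def trace_def)
    qed
    show "inj_on f L"
    proof (rule inj_onI)
      fix x y assume xy: "x \<in> L" "y \<in> L" "f x = f y"
      note P = piece_mem[OF t[OF xy(1)]] piece_mem[OF t[OF xy(2)]]
      have "edge_pt i l (f x) \<in> piece s (edge_pt i j x)" "edge_pt i l (f x) \<in> piece s (edge_pt i j y)"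
        using f[OF xy(1)] f[OF xy(2)] xy(3) by auto
      then have "piece s (edge_pt i j x) = piece s (edge_pt i j y)"
        using piece_eq P by metis
      then have "edge_pt i j x \<in> piece s (edge_pt i j y)" "edge_pt i j y \<in> piece s (edge_pt i j y)"
        using P by simp_all
      moreover obtain A where "normal_cut A (piece s (edge_pt i j y))" using piece_cut[OF s] P by blast
      ultimately show "x = y"
        using normal_cut_edge_unique[of A "piece s (edge_pt i j y)" i j x y] ij(1,2) xy(1,2)
        unfolding L_def by fastforce
    qed
    show "finite R" unfolding R_def using il by (intro finite_level_set[OF s]) auto
  qed
  then show ?thesis by (simp add: level_def L_def R_def)
qed

lemma triangle_atI:
  assumes s: "s \<in> I" and D: "D \<in> pieces \<phi> F s" "normal_triangle i D"
    and ij: "i \<noteq> j" "0 < c" "c < 1" "edge_pt i j c \<in> D"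
  shows "triangle_at s i (level s i j c) D"
  unfolding triangle_at_def
proof (intro conjI allI impI)
  fix l d assume "i \<noteq> l \<and> 0 < d \<and> d < 1 \<and> edge_pt i l d \<in> D"
  then have il: "i \<noteq> l" "0 < d" "d < 1" "edge_pt i l d \<in> D" by auto
  show "level s i l d = level s i j c"
    by (rule order_antisym[OF triangle_level_le[OF s D il ij] triangle_level_le[OF s D ij il]])
qed (fact s D)+

lemma triangle_edge:
  assumes "normal_triangle i D" "i \<noteq> j"
  obtains c where "0 < c" "c < 1" "edge_pt i j c \<in> D"
proof -
  have "\<exists>c>0. c < 1 \<and> edge_pt i j c \<in> D"
    using normal_cut_edge_iff[OF normal_triangle_cut[OF assms(1)] assms(2)] assms(2) by simp
  then show ?thesis using that by blast
qed

lemma triangle_at_ex: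
  assumes "s \<in> I" "D \<in> pieces \<phi> F s" "normal_triangle i D"
  shows "\<exists>k. triangle_at s i k D"
proof -
  obtain j where ij: "i \<noteq> j" using ex_other[of i i i] by metis
  then obtain c where "0 < c" "c < 1" "edge_pt i j c \<in> D" using triangle_edge[OF assms(3)] by blast
  then show ?thesis using triangle_atI[OF assms ij] by blast
qed

text \<open>Among the points of \<open>F\<close> on an edge at \<open>i\<close> the level strictly
  decreases towards \<open>i\<close>, so equal levels force a common point and hence a common
  piece.\<close>

lemma triangle_at_unique:
  assumes D: "triangle_at s i k D" and E: "triangle_at s i k E"
  shows "D = E"
proof -
  obtain j where ij: "i \<noteq> j" using ex_other[of i i i] by metis
  obtain c where c: "0 < c" "c < 1" "edge_pt i j c \<in> D"
    using triangle_edge[OF triangle_atD(3)[OF D] ij] .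
  obtain d where d: "0 < d" "d < 1" "edge_pt i j d \<in> E"
    using triangle_edge[OF triangle_atD(3)[OF E] ij] .
  have s: "s \<in> I" using triangle_atD(1)[OF D] .
  have less: "level s i j y < level s i j x" if "0 < x" "x < y" "y < 1" "edge_pt i j y \<in> trace \<phi> F s" for x y
  proof -
    have "y \<in> {c'. x < c' \<and> c' < 1 \<and> \<phi> s (edge_pt i j c') \<in> F}" using that by (simp add: trace_edge)
    moreover have "y \<notin> {c'. y < c' \<and> c' < 1 \<and> \<phi> s (edge_pt i j c') \<in> F}" by simp
    ultimately have "{c'. y < c' \<and> c' < 1 \<and> \<phi> s (edge_pt i j c') \<in> F} \<subset> {c'. x < c' \<and> c' < 1 \<and> \<phi> s (edge_pt i j c') \<in> F}"
      using that by auto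
    then show ?thesis
      unfolding level_def using s ij that by (intro psubset_card_mono finite_level_set) auto
  qed
  have k: "level s i j c = k" "level s i j d = k"
    using triangle_atD(4)[OF D ij c] triangle_atD(4)[OF E ij d] .
  have pc: "D \<in> pieces \<phi> F s" "E \<in> pieces \<phi> F s" using triangle_atD(2) D E by blast+
  then have "edge_pt i j c \<in> trace \<phi> F s" "edge_pt i j d \<in> trace \<phi> F s"
    using c d pieces_subset by blast+
  then have "c = d" using less[of c d] less[of d c] k c d by linarith
  then show ?thesis using piece_eq[OF pc(1) c(3)] piece_eq[OF pc(2) d(3)] by simp
qed

text \<open>The arc of \<open>D\<close> in the face is connected, so the gluing carries it into one
  piece of \<open>t\<close>. That piece crosses the edges \<open>ij\<close> and \<open>il\<close> at
  level \<open>k\<close>, so it is a triangle linking \<open>i\<close> or a quadrilateral, and in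
  the latter case it has an arc excluded by \<open>nq\<close>.\<close>

lemma face_step:
  assumes D: "triangle_at s (\<pi> i) k D" and x: "x \<in> D" "support x = {\<pi> i, \<pi> j, \<pi> l}"
    and d: "i \<noteq> j" "i \<noteq> l" "j \<noteq> l" and t: "t \<in> I" and gl: "glues s t \<pi> (support x)"
    and nq: "\<And>Q m. \<not> quad_arc_at t Q m (\<phi> s (corner (\<pi> i))) k"
  shows "triangle_at t i k (piece t (permute_coords \<pi> x))"
proof -
  let ?E = "piece t (permute_coords \<pi> x)"
  have s: "s \<in> I" and DP: "D \<in> pieces \<phi> F s" and Dt: "normal_triangle (\<pi> i) D"
    using triangle_atD[OF D] by blast+
  have \<pi>: "bij \<pi>" and gl': "\<And>z. z \<in> face (support x) \<Longrightarrow> \<phi> t (permute_coords \<pi> z) = \<phi> s z"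
    using gl unfolding glues_def by blast+
  have inj: "inj \<pi>" using \<pi> by (rule bij_is_inj)
  let ?C = "permute_coords \<pi> ` (D \<inter> face (support x))"
  have Dtr: "D \<subseteq> trace \<phi> F s" using pieces_subset DP .
  have Ctr: "?C \<subseteq> trace \<phi> F t"
    using Dtr gl' permute_in_tetra[OF \<pi>] by (auto simp: trace_def)
  have "x \<in> face (support x)" using x Dtr by (auto simp: face_def trace_def)
  then have "permute_coords \<pi> x \<in> ?C" using x by blast
  moreover have "connected ?C"
    by (intro connected_continuous_image continuous_permute normal_cut_face_connected[OF normal_triangle_cut[OF Dt]])
  ultimately have CE: "?C \<subseteq> ?E" and xt: "permute_coords \<pi> x \<in> trace \<phi> F t"
    using connected_subset_piece Ctr by blast+
  have E: "?E \<in> pieces \<phi> F t" using piece_mem[OF xt] by blast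
  have *: "\<exists>c. 0 < c \<and> c < 1 \<and> edge_pt i b c \<in> ?E \<and> level t i b c = k" if b: "b = j \<or> b = l" for b
  proof -
    have "\<pi> i \<noteq> \<pi> b" using b d inj by (auto simp: inj_eq)
    then obtain c where c: "0 < c" "c < 1" "edge_pt (\<pi> i) (\<pi> b) c \<in> D" using triangle_edge[OF Dt] by blast
    have "edge_pt (\<pi> i) (\<pi> b) c \<in> face (support x)" using c b x(2) by (intro edge_pt_in_face) auto
    then have "edge_pt i b c \<in> ?E" using c CE permute_edge_pt[OF inj, of i b c] by (metis IntI imageI subsetD)
    moreover have "level s (\<pi> i) (\<pi> b) c = k" using triangle_atD(4)[OF D \<open>\<pi> i \<noteq> \<pi> b\<close> c] .
    moreover have "same_edge s (\<pi> i) (\<pi> b) t i b" using glues_same_edge[OF gl, of i b] b x(2) by auto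
    ultimately show ?thesis using c same_edge_level by (metis order_less_imp_le)
  qed
  obtain c where c: "0 < c" "c < 1" "edge_pt i j c \<in> ?E" "level t i j c = k" using * by blast
  obtain c' where c': "0 < c'" "c' < 1" "edge_pt i l c' \<in> ?E" "level t i l c' = k" using * by blast
  have "same_edge s (\<pi> i) (\<pi> j) t i j" using glues_same_edge[OF gl, of i j] x(2) by auto
  then have v: "\<phi> s (corner (\<pi> i)) = \<phi> t (corner i)" by (rule same_edge_corner)
  have "\<not> normal_quad ?E"
  proof
    assume q: "normal_quad ?E"
    obtain m where m: "m \<noteq> i" "m \<noteq> j" "m \<noteq> l" using ex_other by metis
    have "quad_arc_at t ?E m (\<phi> s (corner (\<pi> i))) k"
      unfolding quad_arc_at_def v using t E q m d c c'
      by (intro conjI exI[of _ i] exI[of _ j] exI[of _ l] exI[of _ c] exI[of _ c']) auto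
    then show False using nq by blast
  qed
  then have "normal_triangle i ?E"
    using normal_disk_two_edges[OF piece_disk[OF t E] d c(1-3) c'(1-3)] by blast
  then show ?thesis using triangle_atI[OF t E _ d(1) c(1-3)] c(4) by simp
qed

text \<open>The disks around a point \<open>p\<close> of the surface on an edge fall into those that are triangles linking
  the given end of the edge and the others. Face gluings never pair a disk of the first kind with
  one of the second, so if both kinds occurred, \<open>p\<close> would be a local cut point of the surface.\<close>

lemma edge_step:
  assumes D: "triangle_at s i k D" and ij: "i \<noteq> j" "0 < c" "c < 1" "edge_pt i j c \<in> D"
    and t0: "t0 \<in> I" "a0 \<noteq> b0" "same_edge s i j t0 a0 b0"
    and nq: "\<And>t Q m. \<not> quad_arc_at t Q m (\<phi> s (corner i)) k"
  shows "triangle_at t0 a0 k (piece t0 (edge_pt a0 b0 c))"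
proof -
  note s = triangle_atD(1)[OF D]
  define p where "p = \<phi> s (edge_pt i j c)"
  define P where "P t a b = piece t (edge_pt a b c)" for t a b
  \<comment> \<open>A slot is one occurrence of the directed edge in some tetrahedron; the points
    over \<open>p\<close> are exactly the points with parameter \<open>c\<close> on slots.\<close>
  define slot where "slot t a b \<longleftrightarrow> t \<in> I \<and> a \<noteq> b \<and> same_edge s i j t a b" for t a b
  have pF: "p \<in> F"
    using pieces_subset[OF triangle_atD(2)[OF D]] ij by (auto simp: p_def trace_def)
  have slot_p: "\<phi> t (edge_pt a b c) = p" if "slot t a b" for t a b
    using that ij by (simp add: slot_def same_edge_def p_def)
  have slot_tr: "edge_pt a b c \<in> trace \<phi> F t" if "slot t a b" for t a b
    using slot_p[OF that] pF ij by (simp add: trace_edge)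
  have slot_P: "P t a b \<in> pieces \<phi> F t" "edge_pt a b c \<in> P t a b" if "slot t a b" for t a b
    using piece_mem[OF slot_tr[OF that]] by (simp_all add: P_def)
  have slot_level: "level t a b c = k" if "slot t a b" for t a b
    using same_edge_level[of s i j t a b c] triangle_atD(4)[OF D ij] that ij by (simp add: slot_def)
  have slot_s: "slot s i j" using s ij by (simp add: slot_def same_edge_def)
  have slot_t0: "slot t0 a0 b0" using t0 by (simp add: slot_def)
  have slot_unique: "a = d \<and> b = e" if "slot t a b" "slot t d e" "{a, b} = {d, e}" for t a b d e
    using that same_edge_not_reversed[of t a b s i j] by (auto simp: slot_def doubleton_eq_iff)
  have fibre: "\<exists>a b. slot t a b \<and> x = edge_pt a b c" if "t \<in> I" "x \<in> tetra" "\<phi> t x = p" for t x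
    using edge_fibre[OF s that(1) ij(1-3) that(2)] that by (auto simp: slot_def p_def)
  have "normal_triangle a0 (P t0 a0 b0)"
  proof (rule ccontr)
    assume bad: "\<not> normal_triangle a0 (P t0 a0 b0)"
    define good where "good t a b \<longleftrightarrow> slot t a b \<and> normal_triangle a (P t a b)" for t a b
    \<comment> \<open>\<open>X\<close> and \<open>Y\<close> collect the good and the bad disks near
      \<open>p\<close>, and \<open>Z\<close> what is left of each disk away from its points over
      \<open>p\<close>. Goodness belongs to slots, not to pieces, because one piece may pass through
      \<open>p\<close> along several edges; the edge neighbourhoods keep these passages
      apart.\<close>
    define X where "X = (\<Union>(t, a, b)\<in>{(t, a, b). good t a b}. \<phi> t ` (P t a b \<inter> closed_edge_nbhd a b))"
    define Y where "Y = (\<Union>(t, a, b)\<in>{(t, a, b). slot t a b \<and> \<not> good t a b}. \<phi> t ` (P t a b \<inter> closed_edge_nbhd a b))"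
    define N where "N t E = (\<Union>(a, b)\<in>{(a, b). slot t a b \<and> edge_pt a b c \<in> E}. edge_nbhd a b)" for t E
    define Z where "Z = (\<Union>t\<in>I. \<Union>E\<in>pieces \<phi> F t. \<phi> t ` (E - N t E))"
    have fin: "finite {(t, a, b). slot t a b}"
      by (rule finite_subset[of _ "I \<times> UNIV \<times> UNIV"]) (auto simp: slot_def finite_I)
    have cl: "closed (\<phi> t ` (E \<inter> C))" if t: "t \<in> I" "E \<in> pieces \<phi> F t" and C: "closed C" for t E C
    proof -
      obtain A where A: "normal_cut A E" using piece_cut[OF t] by blast
      have "compact (E \<inter> C)" using normal_cut_compact[OF A] C by (rule compact_Int_closed)
      moreover have "continuous_on (E \<inter> C) (\<phi> t)"
        using continuous_on_subset[OF continuous_chart[OF t(1)]] normal_cut_subset[OF A] by (meson inf.coboundedI1)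
      ultimately show ?thesis by (intro compact_imp_closed compact_continuous_image)
    qed
    have clX: "closed X" unfolding X_def
    proof (intro closed_UN)
      show "finite {(t, a, b). good t a b}" by (rule finite_subset[OF _ fin]) (auto simp: good_def)
      show "\<forall>u\<in>{(t, a, b). good t a b}. closed (case u of (t, a, b) \<Rightarrow> \<phi> t ` (P t a b \<inter> closed_edge_nbhd a b))"
        using cl slot_P closed_closed_edge_nbhd by (auto simp: good_def slot_def)
    qed
    have clY: "closed Y" unfolding Y_def
    proof (intro closed_UN)
      show "finite {(t, a, b). slot t a b \<and> \<not> good t a b}" by (rule finite_subset[OF _ fin]) auto
      show "\<forall>u\<in>{(t, a, b). slot t a b \<and> \<not> good t a b}. closed (case u of (t, a, b) \<Rightarrow> \<phi> t ` (P t a b \<inter> closed_edge_nbhd a b))"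
        using cl slot_P closed_closed_edge_nbhd by (auto simp: slot_def)
    qed
    have "open (N t E)" for t E
      unfolding N_def using open_edge_nbhd by (intro open_UN) auto
    then have clZ: "closed Z" unfolding Z_def Diff_eq
      using cl finite_I finite_pieces by (intro closed_UN ballI) (auto simp: closed_Compl)
    have cov: "F \<subseteq> X \<union> Y \<union> Z"
    proof
      fix q assume "q \<in> F"
      then obtain t x where x: "t \<in> I" "x \<in> trace \<phi> F t" "q = \<phi> t x" using F_covered by metis
      note E = piece_mem[OF x(2)]
      show "q \<in> X \<union> Y \<union> Z"
      proof (cases "x \<in> N t (piece t x)")
        case False
        then show ?thesis unfolding Z_def using x E by blast
      next
        case True
        then obtain a b where ab: "slot t a b" "edge_pt a b c \<in> piece t x" "x \<in> edge_nbhd a b"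
          unfolding N_def by auto
        have "P t a b = piece t x" unfolding P_def using piece_eq E ab(2) by blast
        then have "q \<in> \<phi> t ` (P t a b \<inter> closed_edge_nbhd a b)"
          using x(3) E ab(3) edge_nbhd_subset_closed by blast
        then show ?thesis using ab(1) unfolding X_def Y_def by blast
      qed
    qed
    have pZ: "p \<notin> Z"
    proof
      assume "p \<in> Z"
      then obtain t E x where t: "t \<in> I" "E \<in> pieces \<phi> F t" and x: "x \<in> E" "x \<notin> N t E" "\<phi> t x = p"
        unfolding Z_def by auto
      have "x \<in> tetra" using x(1) pieces_subset[OF t(2)] by (auto simp: trace_def)
      then obtain a b where ab: "slot t a b" "x = edge_pt a b c" using fibre t x by blast
      then have "x \<in> edge_nbhd a b" using ij edge_pt_in_nbhd by (simp add: slot_def)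
      then have "x \<in> N t E" unfolding N_def using ab x(1) by blast
      then show False using x by blast
    qed
    \<comment> \<open>Outside \<open>Z\<close>, a common point lies in the neighbourhoods of a good
      and a bad slot, and its gluing permutation carries one slot to the other. If it lies on the
      edge, it is \<open>p\<close>; if inside a face, \<open>face_step\<close> makes the bad slot
      good; if inside the tetrahedron, both slots coincide.\<close>
    have int: "X \<inter> Y \<subseteq> insert p Z"
    proof (rule subsetI, rule ccontr)
      fix q assume q: "q \<in> X \<inter> Y" "q \<notin> insert p Z"
      from q(1) obtain t a b y where g: "good t a b" and y: "y \<in> P t a b" "y \<in> closed_edge_nbhd a b" "q = \<phi> t y"
        unfolding X_def by auto
      from q(1) obtain t' a' b' y' where g': "slot t' a' b'" "\<not> good t' a' b'"
        and y': "y' \<in> P t' a' b'" "y' \<in> closed_edge_nbhd a' b'" "q = \<phi> t' y'"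
        unfolding Y_def by auto
      have sl: "slot t a b" using g by (simp add: good_def)
      \<comment> \<open>Avoiding \<open>Z\<close> puts \<open>x\<close> into the open neighbourhood
        of some slot met by the piece; as \<open>x\<close> is also in the closed one of
        \<open>d\<close>, \<open>e\<close>, both belong to the same edge.\<close>
      have nb: "x \<in> edge_nbhd d e" if sl: "slot u d e" and x: "x \<in> P u d e" "x \<in> closed_edge_nbhd d e" "q = \<phi> u x" for u d e x
      proof -
        have u: "u \<in> I" "d \<noteq> e" using sl by (auto simp: slot_def)
        have "x \<in> N u (P u d e)"
          using q(2) x u slot_P(1)[OF sl] unfolding Z_def by blast
        then obtain d' e' where de: "slot u d' e'" "x \<in> edge_nbhd d' e'" unfolding N_def by auto
        then have "{d, e} = {d', e'}"
          using edge_nbhds_meet x(2) u(2) by (simp add: slot_def)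
        then show ?thesis using de(2) edge_nbhd_swap by (auto simp: doubleton_eq_iff)
      qed
      have yN: "y \<in> edge_nbhd a b" using nb[OF sl y] .
      have yN': "y' \<in> edge_nbhd a' b'" using nb[OF g'(1) y'] .
      have t: "t \<in> I" "t' \<in> I" "a \<noteq> b" "a' \<noteq> b'" using sl g'(1) by (auto simp: slot_def)
      have yt: "y \<in> tetra" "y' \<in> tetra"
        using y(1) y'(1) pieces_subset[OF slot_P(1)[OF sl]] pieces_subset[OF slot_P(1)[OF g'(1)]]
        by (auto simp: trace_def)
      obtain \<pi> where \<pi>: "bij \<pi>" "y' = permute_coords \<pi> y" "glues t t' \<pi> (support y)"
        using glue[OF t(1,2) yt] y(3) y'(3) by metis
      obtain a2 b2 where ab2: "a = \<pi> a2" "b = \<pi> b2" using \<pi>(1) by (metis bij_pointE)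
      have inj: "\<pi> x = \<pi> z \<longleftrightarrow> x = z" for x z using bij_is_inj[OF \<pi>(1)] by (simp add: inj_eq)
      have supp: "a \<in> support y" "b \<in> support y" using edge_nbhd_support[OF yt(1) yN] .
      have "y' \<in> edge_nbhd a2 b2"
        using yN unfolding \<pi>(2) ab2 edge_nbhd_def by (simp add: inj)
      then have "{a', b'} = {a2, b2}"
        using edge_nbhds_meet y'(2) t(3,4) ab2 by blast
      moreover have "slot t' a2 b2"
        using sl same_edge_trans glues_same_edge[OF \<pi>(3), of a2 b2] supp ab2 t
        unfolding slot_def by blast
      ultimately have eq: "a2 = a'" "b2 = b'" using slot_unique[OF _ g'(1)] by blast+
      have tri: "triangle_at t a k (P t a b)"
        using triangle_atI[OF t(1) slot_P(1)[OF sl] _ t(3) ij(2,3) slot_P(2)[OF sl]] g slot_level[OF sl]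
        by (simp add: good_def)
      show False
      proof (cases "support y = {a, b}")
        case True
        obtain A where A: "normal_cut A (P t a b)" using piece_cut[OF t(1) slot_P(1)[OF sl]] by blast
        note ye = tetra_two_support[OF yt(1) True t(3)]
        have "y $ a = c"
          using normal_cut_edge_unique[OF A t(3) ye(2,3) ij(2,3)] ye(1) y(1) slot_P(2)[OF sl] by simp
        then have "q = p" using ye(1) y(3) slot_p[OF sl] by simp
        then show False using q(2) by simp
      next
        case False
        then obtain l where l: "l \<in> support y" "l \<noteq> a" "l \<noteq> b" using supp by blast
        obtain l2 where l2: "l = \<pi> l2" using \<pi>(1) by (metis bij_pointE)
        show False
        proof (cases "support y = {a, b, l}")
          case True
          have "\<phi> t (corner a) = \<phi> s (corner i)"
            using sl same_edge_corner[of s i j t a b] by (simp add: slot_def)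
          then have "triangle_at t' a2 k (piece t' (permute_coords \<pi> y))"
            using tri y(1) True t l \<pi>(3) nq unfolding ab2 l2
            by (intro face_step[of t \<pi> a2 k "P t a b" y b2 l2 t']) (auto simp: inj ab2)
          then have "normal_triangle a' (piece t' y')" using triangle_atD(3) \<pi>(2) eq by blast
          moreover have "piece t' y' = P t' a' b'" using piece_eq[OF slot_P(1)[OF g'(1)] y'(1)] .
          ultimately show False using g' by (simp add: good_def)
        next
          case False
          then obtain m where m: "m \<in> support y" "m \<notin> {a, b, l}" using supp l by blast
          then have "UNIV = {a, b, l, m}" using t l by (intro UNIV_4_distinct) auto
          then have "support y = UNIV" using m l supp by auto
          then have same: "t = t'" "y = y'" using interior_disjoint t yt y(3) y'(3) by blast+
          then have "{a, b} = {a', b'}"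
            using edge_nbhds_meet[OF y(2), of a' b'] yN' t by blast
          then show False using slot_unique[of t a b a' b'] sl g g' same by (auto simp: good_def)
        qed
      qed
    qed
    have acc: "\<exists>x\<in>\<phi> t ` (P t a b \<inter> closed_edge_nbhd a b) \<inter> W. x \<noteq> p"
      if sl: "slot t a b" and W: "openin (top_of_set F) W" "p \<in> W" for t a b W
    proof -
      have t: "t \<in> I" "a \<noteq> b" using sl by (auto simp: slot_def)
      note E = slot_P[OF sl]
      obtain A where A: "normal_cut A (P t a b)" using piece_cut[OF t(1) E(1)] by blast
      \<comment> \<open>A corner \<open>l\<close> off the edge is separated by the disk from exactly
        one of \<open>a\<close>, \<open>b\<close>. The second edge crossed in this way shows that
        the piece is not a single point.\<close>
      obtain a1 b1 where ab1: "a1 \<noteq> b1" "a1 \<noteq> a \<or> b1 \<noteq> b" "a1 \<in> A" "b1 \<notin> A" "{a1, b1} \<noteq> {a, b}"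
      proof -
        have ab: "(a \<in> A) \<noteq> (b \<in> A)" using normal_cut_edge_iff[OF A t(2)] E(2) ij by blast
        obtain l where l: "l \<noteq> a" "l \<noteq> b" using ex_other[of a b b] by metis
        show ?thesis
        proof (cases "l \<in> A")
          case True
          then show ?thesis using that[of l a] that[of l b] ab l by auto
        next
          case False
          then show ?thesis using that[of a l] that[of b l] ab l by auto
        qed
      qed
      obtain d where d: "0 < d" "d < 1" "edge_pt a1 b1 d \<in> P t a b"
        using normal_cut_edge_iff[OF A ab1(1)] ab1 by blast
      have "support (edge_pt a1 b1 d) \<noteq> support (edge_pt a b c)"
        using d ij ab1 by (simp add: support_edge_pt)
      then have ne: "P t a b \<noteq> {edge_pt a b c}" using d(3) by auto
      have sub: "P t a b \<subseteq> tetra" using normal_cut_subset[OF A] .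
      have wt: "edge_pt a b c \<in> tetra" using sub E(2) by blast
      have "finite {x \<in> P t a b. \<phi> t x = \<phi> t (edge_pt a b c)}"
        by (rule finite_subset[OF _ finite_fibre[OF t(1,1) wt]]) (use sub in auto)
      then have "\<exists>x\<in>\<phi> t ` (P t a b \<inter> edge_nbhd a b) \<inter> W. x \<noteq> \<phi> t (edge_pt a b c)"
        using W slot_p[OF sl] continuous_on_subset[OF continuous_chart[OF t(1)] sub] piece_image(3)[OF t(1) E(1)]
          edge_pt_in_nbhd[OF ij(2,3) t(2)]
        by (intro image_accumulates[OF normal_cut_connected[OF A] E(2) ne open_edge_nbhd]) auto
      then show ?thesis using edge_nbhd_subset_closed slot_p[OF sl] by blast
    qed
    have gs: "good s i j"
    proof -
      have "P s i j = D" unfolding P_def using piece_eq[OF triangle_atD(2)[OF D] ij(4)] .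
      then show ?thesis using slot_s triangle_atD(3)[OF D] by (simp add: good_def)
    qed
    have bt: "\<not> good t0 a0 b0" using bad by (simp add: good_def)
    show False
    proof (rule no_local_cut_point[OF surface _ clX clY clZ cov pF pZ int])
      fix W assume W: "openin (top_of_set F) W" "p \<in> W"
      show "\<exists>x\<in>X \<inter> W. x \<noteq> p"
        using acc[OF slot_s W] gs unfolding X_def by blast
      show "\<exists>x\<in>Y \<inter> W. x \<noteq> p"
        using acc[OF slot_t0 W] bt slot_t0 unfolding Y_def by blast
    qed simp
  qed
  then show ?thesis
    using triangle_atI[OF t0(1) slot_P(1)[OF slot_t0] _ t0(2) ij(2,3) slot_P(2)[OF slot_t0]] slot_level[OF slot_t0]
    by (simp add: P_def)
qed

section \<open>Vertex links\<close>

text \<open>Otherwise \<open>v\<close> would be a local cut point of \<open>M\<close>.\<close>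

lemma corners_connected:
  assumes C: "C \<subseteq> {(s, i). s \<in> I \<and> \<phi> s (corner i) = v}" "C \<noteq> {}"
    and step: "\<And>s i j t a b. (s, i) \<in> C \<Longrightarrow> t \<in> I \<Longrightarrow> i \<noteq> j \<Longrightarrow> a \<noteq> b \<Longrightarrow> same_edge s i j t a b \<Longrightarrow> (t, a) \<in> C"
  shows "C = {(s, i). s \<in> I \<and> \<phi> s (corner i) = v}"
proof (rule ccontr)
  assume ne: "C \<noteq> {(s, i). s \<in> I \<and> \<phi> s (corner i) = v}"
  define K where "K = {(s, i). s \<in> I \<and> \<phi> s (corner i) = v}"
  \<comment> \<open>With the threshold 1/2, two corner neighbourhoods of one tetrahedron meet only
    where both coordinates equal 1/2, and such points lie in \<open>Z\<close>.\<close>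
  define H where "H i = tetra \<inter> {x. 1/2 \<le> x $ i}" for i
  define X where "X = (\<Union>(s, i)\<in>C. \<phi> s ` H i)"
  define Y where "Y = (\<Union>(s, i)\<in>K - C. \<phi> s ` H i)"
  define Z where "Z = (\<Union>s\<in>I. \<phi> s ` (tetra \<inter> (\<Inter>i\<in>{i. \<phi> s (corner i) = v}. {x. x $ i \<le> 1/2})))"
  have fin: "finite K"
    by (rule finite_subset[of _ "I \<times> UNIV"]) (auto simp: K_def finite_I)
  have cl: "closed (\<phi> s ` (tetra \<inter> E))" if "s \<in> I" "closed E" for s E
  proof -
    have "compact (tetra \<inter> E)" using compact_tetra that(2) by (rule compact_Int_closed)
    moreover have "continuous_on (tetra \<inter> E) (\<phi> s)"
      by (rule continuous_on_subset[OF continuous_chart[OF that(1)]]) auto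
    ultimately show ?thesis by (intro compact_imp_closed compact_continuous_image)
  qed
  have clH: "closed (\<phi> s ` H i)" if "s \<in> I" for s i
    unfolding H_def by (intro cl that closed_Collect_le continuous_intros)
  have clX: "closed X" unfolding X_def
    using finite_subset[OF C(1)] fin C(1) clH by (intro closed_UN) (auto simp: K_def)
  have clY: "closed Y" unfolding Y_def
    using fin clH by (intro closed_UN) (auto simp: K_def)
  have clZ: "closed Z" unfolding Z_def
    using finite_I by (intro closed_UN ballI cl closed_INT closed_Collect_le continuous_intros) auto
  have cov: "M \<subseteq> X \<union> Y \<union> Z"
  proof
    fix q assume "q \<in> M"
    then obtain s x where x: "s \<in> I" "x \<in> tetra" "q = \<phi> s x" using M_eq by blast
    show "q \<in> X \<union> Y \<union> Z"
    proof (cases "\<exists>i. \<phi> s (corner i) = v \<and> 1/2 \<le> x $ i")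
      case True
      then obtain i where i: "\<phi> s (corner i) = v" "1/2 \<le> x $ i" by blast
      then have "q \<in> \<phi> s ` H i" using x by (simp add: H_def)
      moreover have "(s, i) \<in> K" using i x by (simp add: K_def)
      ultimately show ?thesis unfolding X_def Y_def by blast
    next
      case False
      then have "x \<in> tetra \<inter> (\<Inter>i\<in>{i. \<phi> s (corner i) = v}. {x. x $ i \<le> 1/2})"
        using x by auto
      then show ?thesis using x unfolding Z_def by blast
    qed
  qed
  obtain s0 i0 where C0: "(s0, i0) \<in> C" using C(2) by auto
  then have s0: "s0 \<in> I" "\<phi> s0 (corner i0) = v" using C(1) by auto
  have vM: "v \<in> M" using s0 M_eq corner_in_tetra by blast
  have fibre: "\<exists>i. x = corner i \<and> \<phi> t (corner i) = v" if x: "t \<in> I" "x \<in> tetra" "\<phi> t x = v" for t x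
  proof -
    obtain \<pi> where \<pi>: "bij \<pi>" "x = permute_coords \<pi> (corner i0)"
      using glue[OF s0(1) x(1) corner_in_tetra x(2), of i0] s0(2) x(3) by metis
    obtain i where "i0 = \<pi> i" using \<pi>(1) by (metis bij_pointE)
    then show ?thesis using \<pi> permute_corner[OF bij_is_inj[OF \<pi>(1)], of i] x by auto
  qed
  have vZ: "v \<notin> Z"
  proof
    assume "v \<in> Z"
    then obtain t x where x: "t \<in> I" "x \<in> tetra" "\<phi> t x = v"
      and le: "\<And>i. \<phi> t (corner i) = v \<Longrightarrow> x $ i \<le> 1/2"
      unfolding Z_def by auto
    obtain i where "x = corner i" "\<phi> t (corner i) = v" using fibre[OF x] by blast
    then show False using le[of i] by simp
  qed
  have int: "X \<inter> Y \<subseteq> insert v Z"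
  proof (rule subsetI, rule ccontr)
    fix q assume q: "q \<in> X \<inter> Y" "q \<notin> insert v Z"
    from q(1) obtain s i y where si: "(s, i) \<in> C" and y: "y \<in> H i" "q = \<phi> s y" unfolding X_def by auto
    from q(1) obtain t a y' where ta: "(t, a) \<in> K" "(t, a) \<notin> C" and y': "y' \<in> H a" "q = \<phi> t y'" unfolding Y_def by auto
    have st: "s \<in> I" "\<phi> s (corner i) = v" "t \<in> I" "\<phi> t (corner a) = v" using si ta C(1) by (auto simp: K_def)
    have yt: "y \<in> tetra" "y' \<in> tetra" using y y' by (auto simp: H_def)
    \<comment> \<open>Avoiding \<open>Z\<close> yields some coordinate above 1/2. As the coordinates
      sum to 1 and the one at \<open>d\<close> is at least 1/2, it must be that one.\<close>
    have big: "1/2 < x $ d" if "u \<in> I" "x \<in> H d" "q = \<phi> u x" for u d x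
    proof -
      have xt: "x \<in> tetra" and xd: "1/2 \<le> x $ d" using that by (auto simp: H_def)
      have "\<not> x \<in> tetra \<inter> (\<Inter>i\<in>{i. \<phi> u (corner i) = v}. {x. x $ i \<le> 1/2})"
        using q(2) that unfolding Z_def by blast
      then have "\<exists>e. 1/2 < x $ e" using xt by (auto simp: not_le)
      then obtain e where e: "1/2 < x $ e" by blast
      have "e = d"
      proof (rule ccontr)
        assume "e \<noteq> d"
        then have "(\<Sum>l\<in>{e, d}. x $ l) > 1" using xd e by simp
        moreover have "(\<Sum>l\<in>{e, d}. x $ l) \<le> (\<Sum>l\<in>UNIV. x $ l)"
          using tetra_nonneg[OF xt] by (intro sum_mono2) auto
        ultimately show False using xt by (simp add: tetra_def)
      qed
      then show ?thesis using e by simp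
    qed
    obtain \<pi> where \<pi>: "bij \<pi>" "y' = permute_coords \<pi> y" "glues s t \<pi> (support y)"
      using glue[OF st(1,3) yt] y(2) y'(2) by metis
    have inj: "\<pi> x = \<pi> z \<longleftrightarrow> x = z" for x z using bij_is_inj[OF \<pi>(1)] by (simp add: inj_eq)
    have yi: "1/2 < y $ i" using big[OF st(1) y] .
    have ya: "1/2 < y $ \<pi> a" using big[OF st(3) y'] \<pi>(2) by simp
    have ai: "\<pi> a = i"
    proof (rule ccontr)
      assume "\<pi> a \<noteq> i"
      then have "(\<Sum>l\<in>{\<pi> a, i}. y $ l) > 1" using yi ya by simp
      moreover have "(\<Sum>l\<in>{\<pi> a, i}. y $ l) \<le> (\<Sum>l\<in>UNIV. y $ l)"
        using tetra_nonneg[OF yt(1)] by (intro sum_mono2) auto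
      ultimately show False using yt by (simp add: tetra_def)
    qed
    have iy: "i \<in> support y" using yi by (auto simp: support_def)
    \<comment> \<open>A point other than \<open>v\<close> has a second corner \<open>j\<close> in
      its support. The gluing then identifies an edge at \<open>i\<close> with an edge at
      \<open>a\<close>, and \<open>step\<close> brings \<open>(t, a)\<close> into
      \<open>C\<close>.\<close>
    show False
    proof (cases "support y = {i}")
      case True
      then have "q = v" using tetra_one_support[OF yt(1)] st y by auto
      then show False using q by simp
    next
      case False
      then obtain j where j: "j \<in> support y" "j \<noteq> i" using iy by blast
      obtain b where b: "j = \<pi> b" using \<pi>(1) by (metis bij_pointE)
      have "same_edge s i j t a b"
        using glues_same_edge[OF \<pi>(3), of a b] iy j ai b by simp
      moreover have "a \<noteq> b" using j ai b by auto
      ultimately show False using step[OF si st(3), of j a b] j ta by simp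
    qed
  qed
  have acc: "\<exists>x\<in>\<phi> s ` H i \<inter> W. x \<noteq> v"
    if si: "(s, i) \<in> K" and W: "openin (top_of_set M) W" "v \<in> W" for s i W
  proof -
    have s: "s \<in> I" "\<phi> s (corner i) = v" using si by (auto simp: K_def)
    have "convex {x :: real^4. 1/2 \<le> x $ i}"
      using convex_halfspace_ge[where a = "axis i 1 :: real^4" and b = "1/2"] by (simp add: inner_axis')
    then have "convex (H i)" unfolding H_def by (intro convex_Int convex_tetra)
    then have con: "connected (H i)" by (rule convex_connected)
    have c: "corner i \<in> H i" using corner_in_tetra by (simp add: H_def)
    obtain j where j: "j \<noteq> i" using ex_other[of i i i] by metis
    then have "edge_pt i j (1/2) \<in> H i" by (simp add: H_def edge_pt_in_tetra edge_pt_nth)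
    moreover have "edge_pt i j (1/2) \<noteq> corner i"
      using j by (auto simp: vec_eq_iff edge_pt_nth axis_def)
    ultimately have ne: "H i \<noteq> {corner i}" by blast
    have sub: "H i \<subseteq> tetra" by (auto simp: H_def)
    have "finite {x \<in> H i. \<phi> s x = \<phi> s (corner i)}"
      by (rule finite_subset[OF _ finite_fibre[OF s(1) s(1) corner_in_tetra[of i]]]) (use sub in auto)
    then have "\<exists>x\<in>\<phi> s ` (H i \<inter> UNIV) \<inter> W. x \<noteq> \<phi> s (corner i)"
      using W s continuous_on_subset[OF continuous_chart[OF s(1)] sub] M_eq sub
      by (intro image_accumulates[OF con c ne open_UNIV]) auto
    then show ?thesis using s by simp
  qed
  obtain s1 i1 where C1: "(s1, i1) \<in> K - C" using ne C(1) unfolding K_def by blast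
  have mf: "manifold_with_boundary TYPE(real^3) M" using compact_3 by (simp add: compact_3_manifold_def)
  show False
  proof (rule no_local_cut_point[OF mf _ clX clY clZ cov vM vZ int])
    fix W assume W: "openin (top_of_set M) W" "v \<in> W"
    show "\<exists>x\<in>X \<inter> W. x \<noteq> v"
      using acc[of s0 i0, OF _ W] s0 C0 unfolding X_def K_def by blast
    show "\<exists>x\<in>Y \<inter> W. x \<noteq> v"
      using acc[of s1 i1, OF _ W] C1 unfolding Y_def by blast
  qed simp
qed

text \<open>The class is closed under contact in \<open>M\<close>. The open face containing the
  contact point decides: \<open>edge_step\<close> on an edge, \<open>face_step\<close> in a face,
  and inside a tetrahedron both disks are the same.\<close>

lemma triangle_neighbour:
  assumes D: "triangle_at s i k D" and y: "y \<in> D" and t: "t \<in> I" "y' \<in> trace \<phi> F t" "\<phi> s y = \<phi> t y'"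
    and nq: "\<And>t Q m. \<not> quad_arc_at t Q m (\<phi> s (corner i)) k"
  shows "\<exists>a. \<phi> t (corner a) = \<phi> s (corner i) \<and> triangle_at t a k (piece t y')"
proof -
  note s = triangle_atD(1)[OF D] and DP = triangle_atD(2)[OF D] and Dt = triangle_atD(3)[OF D]
  have yt: "y \<in> tetra" "y' \<in> tetra" using pieces_subset[OF DP] y t(2) by (auto simp: trace_def)
  obtain \<pi> where \<pi>: "bij \<pi>" "y' = permute_coords \<pi> y" "glues s t \<pi> (support y)"
    using glue[OF s t(1) yt t(3)] by metis
  have inj: "\<pi> x = \<pi> z \<longleftrightarrow> x = z" for x z using bij_is_inj[OF \<pi>(1)] by (simp add: inj_eq)
  obtain a where a: "i = \<pi> a" using \<pi>(1) by (metis bij_pointE)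
  have i: "i \<in> support y" "support y \<noteq> {i}" using normal_triangle_support[OF Dt y] by auto
  then obtain j where j: "j \<in> support y" "j \<noteq> i" by blast
  obtain b where b: "j = \<pi> b" using \<pi>(1) by (metis bij_pointE)
  have ab: "a \<noteq> b" using j a b by auto
  have se: "same_edge s i j t a b" using glues_same_edge[OF \<pi>(3), of a b] i j a b by simp
  have v: "\<phi> t (corner a) = \<phi> s (corner i)" using same_edge_corner[OF se] by simp
  show ?thesis
  proof (cases "support y = {i, j}")
    case True
    note ye = tetra_two_support[OF yt(1) True j(2)[symmetric]]
    have "y' = edge_pt a b (y $ i)"
      using \<pi>(2) ye(1) permute_edge_pt[OF bij_is_inj[OF \<pi>(1)], of a b] a b by metis
    moreover have "edge_pt i j (y $ i) \<in> D" using ye(1) y by simp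
    ultimately have "triangle_at t a k (piece t y')"
      using edge_step[OF D j(2)[symmetric] ye(2,3) _ t(1) ab se nq] by simp
    then show ?thesis using v by blast
  next
    case False
    then obtain l where l: "l \<in> support y" "l \<noteq> i" "l \<noteq> j" using i j by blast
    obtain d where d: "l = \<pi> d" using \<pi>(1) by (metis bij_pointE)
    show ?thesis
    proof (cases "support y = {i, j, l}")
      case True
      have "triangle_at t a k (piece t (permute_coords \<pi> y))"
        using D y True t l j \<pi>(3) nq unfolding a b d
        by (intro face_step[of s \<pi> a k D y b d t]) (auto simp: inj)
      then show ?thesis using v \<pi>(2) by blast
    next
      case False
      then obtain m where m: "m \<in> support y" "m \<notin> {i, j, l}" using i j l by blast
      then have "UNIV = {i, j, l, m}" using j l by (intro UNIV_4_distinct) auto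
      then have "support y = UNIV" using m l i j by auto
      then have "s = t" "y = y'" using interior_disjoint[OF s t(1) yt(1) _ yt(2) t(3)] by blast+
      then show ?thesis using D piece_eq[OF DP y] by auto
    qed
  qed
qed

text \<open>Corners at \<open>v\<close> are reached from \<open>i\<close> through identified edges,
  so each carries a triangle of the class in the component \<open>C\<close> of \<open>D\<close>. The
  class and the remaining pieces are disjoint closed sets covering \<open>F\<close>, hence
  \<open>C\<close> consists of the class alone.\<close>

lemma no_quad_arc_vertex_linking:
  assumes D: "triangle_at s i k D" and v: "v = \<phi> s (corner i)"
    and nq: "\<And>t Q m. \<not> quad_arc_at t Q m v k"
  shows "\<exists>C\<in>components F. vertex_linking I \<phi> v C"
proof -
  note s = triangle_atD(1)[OF D] and DP = triangle_atD(2)[OF D]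
  obtain d where d: "d \<in> D"
    using triangle_edge[OF triangle_atD(3)[OF D]] ex_other[of i i i] by metis
  obtain C where C: "C \<in> components F" "\<phi> s ` D \<subseteq> C"
    using exists_component_superset[OF piece_image(3)[OF s DP] _ piece_image(2)[OF s DP]] d piece_image(3)[OF s DP] by blast
  have in_C: "\<phi> t ` E \<subseteq> C" if "t \<in> I" "E \<in> pieces \<phi> F t" "x \<in> E" "\<phi> t x \<in> C" for t E x
    using components_maximal[OF C(1) piece_image(2,3)[OF that(1,2)]] that by blast
  define K where "K = {(t, a). t \<in> I \<and> \<phi> t (corner a) = v}"
  \<comment> \<open>Membership in \<open>C\<close> is propagated together with the level, since a
    class might a priori be spread over several components.\<close>
  define A where "A = {(t, a). (t, a) \<in> K \<and> (\<exists>E. triangle_at t a k E \<and> \<phi> t ` E \<subseteq> C)}"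
  have "A = {(t, a). t \<in> I \<and> \<phi> t (corner a) = v}"
  proof (rule corners_connected)
    show "A \<subseteq> {(t, a). t \<in> I \<and> \<phi> t (corner a) = v}" by (auto simp: A_def K_def)
    have "(s, i) \<in> A" using D C s v by (auto simp: A_def K_def)
    then show "A \<noteq> {}" by blast
    fix t a b u e f assume *: "(t, a) \<in> A" "u \<in> I" "a \<noteq> b" "e \<noteq> f" "same_edge t a b u e f"
    then obtain E where E: "triangle_at t a k E" "\<phi> t ` E \<subseteq> C" and va: "\<phi> t (corner a) = v"
      by (auto simp: A_def K_def)
    obtain c where c: "0 < c" "c < 1" "edge_pt a b c \<in> E" using triangle_edge[OF triangle_atD(3)[OF E(1)] *(3)] .
    let ?G = "piece u (edge_pt e f c)"
    have G: "triangle_at u e k ?G" using edge_step[OF E(1) *(3) c *(2,4,5)] nq va by blast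
    have eq: "\<phi> u (edge_pt e f c) = \<phi> t (edge_pt a b c)" using *(5) c by (simp add: same_edge_def)
    have "edge_pt e f c \<in> trace \<phi> F u"
      using eq c pieces_subset[OF triangle_atD(2)[OF E(1)]] by (auto simp: trace_def edge_pt_in_tetra)
    then have "edge_pt e f c \<in> ?G" using piece_mem by blast
    moreover have "\<phi> u (edge_pt e f c) \<in> C" using eq E(2) c by auto
    ultimately have "\<phi> u ` ?G \<subseteq> C" using in_C[OF *(2) triangle_atD(2)[OF G]] by blast
    moreover have "\<phi> u (corner e) = v" using same_edge_corner[OF *(5)] va by simp
    ultimately show "(u, e) \<in> A" using G *(2) by (auto simp: A_def K_def)
  qed
  then have AK: "A = K" by (simp add: K_def)
  define T where "T t a = (SOME E. triangle_at t a k E \<and> \<phi> t ` E \<subseteq> C)" for t a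
  have T: "triangle_at t a k (T t a)" "\<phi> t ` T t a \<subseteq> C" if "(t, a) \<in> K" for t a
  proof -
    have "\<exists>E. triangle_at t a k E \<and> \<phi> t ` E \<subseteq> C" using that AK unfolding A_def by blast
    from someI_ex[OF this] show "triangle_at t a k (T t a)" "\<phi> t ` T t a \<subseteq> C" by (simp_all add: T_def)
  qed
  define R where "R t = (\<Union>a\<in>{a. \<phi> t (corner a) = v}. T t a)" for t
  have R: "y' \<in> R u" if t: "t \<in> I" "y \<in> R t" "u \<in> I" "y' \<in> trace \<phi> F u" "\<phi> t y = \<phi> u y'" for t u y y'
  proof -
    obtain a where a: "(t, a) \<in> K" "y \<in> T t a" using t unfolding R_def K_def by blast
    then have va: "\<phi> t (corner a) = v" by (simp add: K_def)
    obtain e where e: "\<phi> u (corner e) = v" "triangle_at u e k (piece u y')"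
      using triangle_neighbour[OF T(1)[OF a(1)] a(2) t(3,4,5)] nq va by auto
    have "(u, e) \<in> K" using e t by (simp add: K_def)
    then have "piece u y' = T u e" using triangle_at_unique[OF e(2)] T(1) by blast
    then show ?thesis using piece_mem[OF t(4)] e(1) unfolding R_def by blast
  qed
  have Rtr: "R t \<subseteq> trace \<phi> F t" if "t \<in> I" for t
    using pieces_subset triangle_atD(2) T(1) that unfolding R_def K_def by blast
  define X where "X = (\<Union>(t, a)\<in>K. \<phi> t ` T t a)"
  \<comment> \<open>\<open>Y\<close> is a finite union of whole pieces, hence closed. A piece
    touching the class in \<open>M\<close> would by \<open>R\<close> share a point with some
    \<open>T u a\<close> and therefore equal it.\<close>
  define Y where "Y = (\<Union>t\<in>I. \<Union>E\<in>{E \<in> pieces \<phi> F t. \<not> E \<subseteq> R t}. \<phi> t ` E)"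
  have XR: "X = (\<Union>t\<in>I. \<phi> t ` R t)" unfolding X_def R_def K_def by blast
  have finK: "finite K"
    by (rule finite_subset[of _ "I \<times> UNIV"]) (auto simp: K_def finite_I)
  have "closed (\<phi> t ` T t a)" if "(t, a) \<in> K" for t a
    using piece_image(1) triangle_atD(1,2)[OF T(1)[OF that]] compact_imp_closed by blast
  then have clX: "closed X" unfolding X_def using finK by (intro closed_UN) auto
  have clY: "closed Y" unfolding Y_def
    using finite_I finite_pieces piece_image(1) compact_imp_closed by (intro closed_UN ballI) auto
  have "X \<inter> Y = {}"
  proof (rule ccontr)
    assume "X \<inter> Y \<noteq> {}"
    then obtain q where q: "q \<in> X" "q \<in> Y" by blast
    obtain t y where t: "t \<in> I" "y \<in> R t" "q = \<phi> t y" using q(1) unfolding XR by blast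
    obtain u E where uE: "u \<in> I" "E \<in> {E \<in> pieces \<phi> F u. \<not> E \<subseteq> R u}" "q \<in> \<phi> u ` E"
      using q(2) unfolding Y_def UN_iff by blast
    then obtain y' where u: "u \<in> I" "E \<in> pieces \<phi> F u" "\<not> E \<subseteq> R u" "y' \<in> E" "\<phi> t y = \<phi> u y'"
      using t(3) by (metis (mono_tags, lifting) imageE mem_Collect_eq)
    have "y' \<in> R u" using R[OF t(1,2) u(1) _ u(5)] pieces_subset[OF u(2)] u(4) by blast
    then obtain a where a: "(u, a) \<in> K" "y' \<in> T u a" unfolding R_def K_def using u by blast
    have "E = T u a"
      using piece_eq[OF u(2,4)] piece_eq[OF triangle_atD(2)[OF T(1)[OF a(1)]] a(2)] by simp
    then show False using u(3) a(1) unfolding R_def K_def by blast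
  qed
  moreover have "F \<subseteq> X \<union> Y"
  proof
    fix q assume "q \<in> F"
    then obtain t x where x: "t \<in> I" "x \<in> trace \<phi> F t" "q = \<phi> t x" using F_covered by metis
    show "q \<in> X \<union> Y" unfolding XR Y_def using piece_mem[OF x(2)] x by blast
  qed
  moreover have "connected C" "C \<subseteq> F" using C(1) in_components_connected in_components_subset by blast+
  moreover have "\<phi> s d \<in> X \<inter> C"
  proof -
    have "(s, i) \<in> K" using s v by (simp add: K_def)
    moreover have "T s i = D" using triangle_at_unique[OF D] T(1) calculation by blast
    ultimately show ?thesis unfolding X_def using d C(2) by blast
  qed
  ultimately have CX: "C \<subseteq> X"
    using connected_closedD[of C X Y] clX clY by blast
  have "trace \<phi> C t = R t" if t: "t \<in> I" for t
  proof (intro equalityI subsetI)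
    fix x assume x: "x \<in> trace \<phi> C t"
    then have xF: "x \<in> trace \<phi> F t" using \<open>C \<subseteq> F\<close> by (auto simp: trace_def)
    obtain u y where "u \<in> I" "y \<in> R u" "\<phi> u y = \<phi> t x" using x CX unfolding XR trace_def by auto
    then show "x \<in> R t" using R t xF by blast
  next
    fix x assume x: "x \<in> R t"
    then have "\<phi> t x \<in> C" unfolding R_def using T(2) t by (auto simp: K_def)
    then show "x \<in> trace \<phi> C t" using x Rtr[OF t] by (auto simp: trace_def)
  qed
  moreover have "disjoint_family_on (T t) {a. \<phi> t (corner a) = v}" if t: "t \<in> I" for t
  proof (unfold disjoint_family_on_def, intro ballI impI, rule ccontr)
    fix a b assume ab: "a \<in> {a. \<phi> t (corner a) = v}" "b \<in> {a. \<phi> t (corner a) = v}" "a \<noteq> b" "T t a \<inter> T t b \<noteq> {}"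
    then have Tab: "triangle_at t a k (T t a)" "triangle_at t b k (T t b)" using T(1) t by (auto simp: K_def)
    then have "T t a = T t b"
      using ab(4) piece_eq[OF triangle_atD(2)[OF Tab(1)]] piece_eq[OF triangle_atD(2)[OF Tab(2)]] by blast
    then show False using normal_triangle_unique triangle_atD(3) Tab ab(3) by metis
  qed
  moreover have "normal_triangle a (T t a)" if "t \<in> I" "\<phi> t (corner a) = v" for t a
    using triangle_atD(3)[OF T(1)] that by (simp add: K_def)
  ultimately have "vertex_linking I \<phi> v C"
    unfolding vertex_linking_def Let_def R_def by (intro exI[of _ T]) auto
  then show ?thesis using C(1) by blast
qed

text \<open>In the face opposite to \<open>m\<close>, the corner \<open>a\<close> is the one that
  \<open>Q\<close> separates from both others, so it is determined. Exchanging \<open>b\<close> and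
  \<open>d\<close> does not change the level, because both edges are required to have level
  \<open>k\<close>.\<close>

lemma quad_arc_at_unique:
  assumes "quad_arc_at s Q m v k" "quad_arc_at s Q m v' k'"
  shows "v = v' \<and> k = k'"
proof -
  obtain a b d x y where q: "distinct [a, b, d, m]" "0 < x" "x < 1" "0 < y" "y < 1"
    "edge_pt a b x \<in> Q" "edge_pt a d y \<in> Q" and v: "v = \<phi> s (corner a)" "level s a b x = k" "level s a d y = k"
    using assms(1) unfolding quad_arc_at_def by blast
  obtain a' b' d' x' y' where q': "distinct [a', b', d', m]" "0 < x'" "x' < 1" "0 < y'" "y' < 1"
    "edge_pt a' b' x' \<in> Q" "edge_pt a' d' y' \<in> Q" and v': "v' = \<phi> s (corner a')" "level s a' b' x' = k'"
    using assms(2) unfolding quad_arc_at_def by blast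
  obtain A where A: "normal_cut A Q"
    using assms(1) piece_cut unfolding quad_arc_at_def by blast
  have sides: "(a \<in> A) \<noteq> (b \<in> A)" "(a \<in> A) \<noteq> (d \<in> A)" "(a' \<in> A) \<noteq> (b' \<in> A)" "(a' \<in> A) \<noteq> (d' \<in> A)"
    using normal_cut_edge_iff[OF A, of a b] normal_cut_edge_iff[OF A, of a d] normal_cut_edge_iff[OF A, of a' b'] normal_cut_edge_iff[OF A, of a' d'] q q'
    by auto
  have "UNIV = {a, b, d, m}" using UNIV_4_distinct[OF q(1)] .
  then have mem: "e \<in> {a, b, d, m}" for e by blast
  have "a' = a" using mem[of a'] mem[of b'] mem[of d'] q(1) q'(1) sides by auto
  moreover have "b' = b \<or> b' = d" using mem[of b'] q'(1) calculation by auto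
  moreover have "x' = x" if "a' = a" "b' = b"
    using normal_cut_edge_unique[OF A, of a b x' x] that q q' by auto
  moreover have "x' = y" if "a' = a" "b' = d"
    using normal_cut_edge_unique[OF A, of a d x' y] that q q' by auto
  ultimately show ?thesis using v v' by auto
qed

end

section \<open>Counting triangles by the arcs of quadrilaterals\<close>

theorem theorem1p6:
  fixes M F :: "'a::t2_space set"
    and I :: "'i set" and \<phi> :: "'i \<Rightarrow> real^4 \<Rightarrow> 'a"
  assumes "compact_3_manifold M"
    and "pseudo_triangulation M I \<phi>"
    and "normal_surface M I \<phi> F"
    and "\<And>C v. C \<in> components F \<Longrightarrow> v \<in> vertices I \<phi> \<Longrightarrow> \<not> vertex_linking I \<phi> v C"
  shows "num_triangles I \<phi> F \<le> 4 * max_linking_number I \<phi> * num_quads I \<phi> F"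
proof -
  interpret normal_in_triangulation M F I \<phi>
    by (unfold_locales) (fact assms)+
  define QS where "QS = {(s, Q). s \<in> I \<and> Q \<in> pieces \<phi> F s \<and> normal_quad Q}"
  define TS where "TS = {(s, D). s \<in> I \<and> D \<in> pieces \<phi> F s \<and> (\<exists>i. normal_triangle i D)}"
  define B where "B = {(v, k). \<exists>s i D. triangle_at s i k D \<and> v = \<phi> s (corner i)}"
  define L where "L v = {(s, i). s \<in> I \<and> \<phi> s (corner i) = v}" for v
  \<comment> \<open>The corner \<open>m\<close> names a face of the tetrahedron. Where there is no
    arc of the required kind the value is arbitrary; what counts is that \<open>f\<close> reaches
    all of \<open>B\<close>.\<close>
  define f where "f = (\<lambda>((s, Q), m). SOME w. quad_arc_at s Q m (fst w) (snd w))"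
  define N where "N = max_linking_number I \<phi>"
  have finQ: "finite QS"
    by (rule finite_subset[of _ "Sigma I (pieces \<phi> F)"]) (auto simp: QS_def finite_I finite_pieces)
  have B: "B \<subseteq> f ` (QS \<times> UNIV)"
  proof (intro subrelI)
    fix v k assume "(v, k) \<in> B"
    then obtain s i D where D: "triangle_at s i k D" "v = \<phi> s (corner i)" unfolding B_def by blast
    then have "v \<in> vertices I \<phi>" using triangle_atD(1) unfolding vertices_def by blast
    then obtain t Q m where q: "quad_arc_at t Q m v k"
      using no_quad_arc_vertex_linking[OF D] assms(4) by blast
    then have "f ((t, Q), m) = (v, k)"
      unfolding f_def using quad_arc_at_unique by (auto intro!: some_equality)
    moreover have "(t, Q) \<in> QS" using q by (auto simp: QS_def quad_arc_at_def)
    ultimately show "(v, k) \<in> f ` (QS \<times> UNIV)" by (metis SigmaI UNIV_I imageI)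
  qed
  have finB: "finite B" using B finQ by (meson finite_SigmaI finite finite_imageI finite_subset)
  have finL: "finite (L v)" for v
    by (rule finite_subset[of _ "I \<times> UNIV"]) (auto simp: L_def finite_I)
  have "vertices I \<phi> = (\<lambda>(s, i). \<phi> s (corner i)) ` (I \<times> UNIV)"
    unfolding vertices_def by auto
  then have finV: "finite (vertices I \<phi>)" using finite_I by simp
  have LN: "card (L v) \<le> N" if "(v, k) \<in> B" for v k
  proof -
    have "v \<in> vertices I \<phi>" using that triangle_atD(1) unfolding B_def vertices_def by blast
    then have "linking_number I \<phi> v \<le> N"
      unfolding N_def max_linking_number_def using finV by (intro Max_ge) auto
    then show ?thesis by (simp add: linking_number_def L_def)
  qed
  \<comment> \<open>By \<open>triangle_at_unique\<close> a triangle is recovered from its vertex,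
    level and corner, so a class \<open>w\<close> contributes at most
    \<open>card (L (fst w))\<close> triangles.\<close>
  have "TS \<subseteq> (\<lambda>((v, k), (s, i)). (s, SOME D. triangle_at s i k D)) ` (SIGMA w:B. L (fst w))"
  proof (intro subrelI)
    fix s D assume "(s, D) \<in> TS"
    then obtain i k where D: "triangle_at s i k D" using triangle_at_ex unfolding TS_def by blast
    then have "(SOME D. triangle_at s i k D) = D" by (rule some_equality) (fact triangle_at_unique[OF _ D])
    moreover have "((\<phi> s (corner i), k), (s, i)) \<in> (SIGMA w:B. L (fst w))"
      using D triangle_atD(1)[OF D] by (auto simp: B_def L_def)
    ultimately show "(s, D) \<in> (\<lambda>((v, k), (s, i)). (s, SOME D. triangle_at s i k D)) ` (SIGMA w:B. L (fst w))"
      by (force intro: rev_image_eqI)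
  qed
  then have "card TS \<le> card (SIGMA w:B. L (fst w))"
    using finB finL by (intro surj_card_le) auto
  also have "\<dots> = (\<Sum>w\<in>B. card (L (fst w)))" using finB finL by simp
  also have "\<dots> \<le> card B * N" using sum_bounded_above[of B "\<lambda>w. card (L (fst w))" N] LN by auto
  also have "card B \<le> card (QS \<times> (UNIV :: 4 set))" using surj_card_le[OF _ B] finQ by simp
  \<comment> \<open>The factor 4 is the number of choices for \<open>m\<close>, that is, of faces of
    a tetrahedron.\<close>
  also have "\<dots> = 4 * card QS" by (simp add: card_cartesian_product)
  finally show ?thesis
    by (simp add: num_triangles_def num_quads_def TS_def QS_def N_def mult_ac)
qed
end
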